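(* Let $w\in\mathbb{R}^n$ lie in the row span of $A$ with $w_j>0$ for all $j$, and assume the rank of $A$ cannot be reduced by removing one column. Then $0<|Z_{n,\mathrm{mix}}|<\infty$, $0<|Z_{n,w,\eta}|<\infty$ for every $\eta\in\mathbb{R}^m$, and for every set $E=E_1\times\cdots\times E_n$ with each $E_j$ an interval in $\mathbb{R}$, $$P_n(E)=\int_{\mathbb{R}^m}P_{n,w,\eta}(E)\,dP_{n,\mathrm{mix}}(\eta),$$ where $$P_{n,w,\eta}(B):=\frac{1}{Z_{n,w,\eta}}\int_B e^{-\sum_{j=1}^n(w_j-\mathrm{i}\langle\eta,A_{\bullet j}\rangle)x_j}\mathbf 1_{\mathbb{R}^n_{\ge0}}(x)\,dx,\quad Z_{n,w,\eta}:=\int_{\mathbb{R}^n}e^{-\sum_{j=1}^n(w_j-\mathrm{i}\langle\eta,A_{\bullet j}\rangle)x_j}\mathbf 1_{\mathbb{R}^n_{\ge0}}(x)\,dx,$$ and $P_{n,\mathrm{mix}}$ is the complex measure on $\mathbb{R}^m$ $$dP_{n,\mathrm{mix}}(\eta)=\frac{1}{Z_{n,\mathrm{mix}}}\mathbb{E}_{P_{n,w}}e^{\mathrm{i}\sum_{j=1}^n\langle\eta,A_{\bullet j}\rangle X_j-\mathrm{i}\langle\eta,b\rangle}\,d\eta,\quad Z_{n,\mathrm{mix}}:=\int_{\mathbb{R}^m}\mathbb{E}_{P_{n,w}}e^{\mathrm{i}\sum_{j=1}^n\langle\eta,A_{\bullet j}\rangle X_j-\mathrm{i}\langle\eta,b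\rangle}\,d\eta.$$
   Context: Fix $n>m\ge1$. $A$ is a real $m\times n$ matrix of rank $m$ with all entries strictly positive, $b\in\mathbb{R}^m$ has strictly positive entries, and $K_n:=\{x\in\mathbb{R}^n: x\ge0,\ Ax=b\}$ is compact and contains a point with all coordinates strictly positive. $P_n$ is the uniform distribution on $K_n$: $P_n(E)=H^{n-m}(E\cap K_n)/H^{n-m}(K_n)$, $H^{n-m}$ the $(n-m)$-dimensional Hausdorff measure. For $w$ with all $w_j>0$, $P_{n,w}$ is the probability measure with density $(\prod_j w_j)e^{-\sum_jw_jx_j}\mathbf 1_{x\ge0}$, and $X=(X_1,\dots,X_n)\sim P_{n,w}$ inside $\mathbb{E}_{P_{n,w}}$. $A_{\bullet j}$ denotes the $j$-th column of $A$, $\mathrm{i}$ the imaginary unit. *)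

theory Defs
  imports "HOL-Analysis.Analysis" "HOL-Probability.Probability"
begin

definition hausdorff_measure :: "real \<Rightarrow> 'a::metric_space set \<Rightarrow> ennreal" where
  "hausdorff_measure s S =
     ennreal (pi powr (s/2) / (Gamma (s/2 + 1) * 2 powr s)) *
     (SUP \<delta>\<in>{0<..}. INF C \<in> {C :: nat \<Rightarrow> 'a set. S \<subseteq> (\<Union>i. C i) \<and>
          (\<forall>i. bounded (C i) \<and> diameter (C i) \<le> \<delta>)}.
        (\<Sum>i. ennreal (diameter (C i) powr s)))"

definition Kpoly :: "real^'n^'m \<Rightarrow> real^'m \<Rightarrow> (real^'n) set" where
  "Kpoly A b = {x. (\<forall>j. 0 \<le> x$j) \<and> A *v x = b}"

definition P_unif :: "real^'n^'m \<Rightarrow> real^'m \<Rightarrow> (real^'n) set \<Rightarrow> real" where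
  "P_unif A b E =
     enn2real (hausdorff_measure (real (CARD('n) - CARD('m))) (E \<inter> Kpoly A b)) /
     enn2real (hausdorff_measure (real (CARD('n) - CARD('m))) (Kpoly A b))"

definition orthant :: "(real^'n) set" where
  "orthant = {x. \<forall>j. 0 \<le> x$j}"

definition P_exp :: "real^'n \<Rightarrow> (real^'n) measure" where
  "P_exp w = density lborel
     (\<lambda>x. ennreal ((\<Prod>j\<in>UNIV. w$j) * exp (- (\<Sum>j\<in>UNIV. w$j * x$j)) * indicator orthant x))"

definition cweight :: "real^'n^'m \<Rightarrow> real^'n \<Rightarrow> real^'m \<Rightarrow> real^'n \<Rightarrow> complex" where
  "cweight A w \<eta> x =
     exp (- (\<Sum>j\<in>UNIV. (complex_of_real (w$j) - \<i> * complex_of_real (\<eta> \<bullet> column j A))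
                         * complex_of_real (x$j))) * indicator orthant x"

definition Z_weta :: "real^'n^'m \<Rightarrow> real^'n \<Rightarrow> real^'m \<Rightarrow> complex" where
  "Z_weta A w \<eta> = (LINT x|lborel. cweight A w \<eta> x)"

definition P_weta :: "real^'n^'m \<Rightarrow> real^'n \<Rightarrow> real^'m \<Rightarrow> (real^'n) set \<Rightarrow> complex" where
  "P_weta A w \<eta> B = (LINT x:B|lborel. cweight A w \<eta> x) / Z_weta A w \<eta>"

definition mix_dens :: "real^'n^'m \<Rightarrow> real^'m \<Rightarrow> real^'n \<Rightarrow> real^'m \<Rightarrow> complex" where
  "mix_dens A b w \<eta> =
     (LINT x|P_exp w. exp (\<i> * complex_of_real ((\<Sum>j\<in>UNIV. (\<eta> \<bullet> column j A) * x$j) - \<eta> \<bullet> b)))"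

definition Z_mix :: "real^'n^'m \<Rightarrow> real^'m \<Rightarrow> real^'n \<Rightarrow> complex" where
  "Z_mix A b w = (LINT \<eta>|lborel. mix_dens A b w \<eta>)"

end

theory Submission
  imports Defs
begin

text \<open>The numerator and the denominator of the mixture formula are both of the form
  \<open>\<integral> e^{-i\<langle>\<eta>,b\<rangle>} \<phi>(\<eta>) d\<eta>\<close>, where \<open>\<phi>\<close> is the Fourier transform of the image under \<open>A\<close> of the
  exponential weight restricted to a box. Fourier inversion evaluates such an integral as the density of that
  image at \<open>b\<close>, i.e. as a multiple of the integral of the weight over the slice \<open>A x = b\<close> of the box;
  the weight is constant on the slice because \<open>w\<close> lies in the row span, so only the volume of the slice remains.
  The hypothesis on deleting columns is used twice: it makes \<open>\<phi>\<close> integrable, and it prevents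
  the kernel of \<open>A\<close> from lying in a coordinate hyperplane, so that almost every point of the slice avoids the
  boundary of the box and the Gaussian-regularised inversion integral converges to the slice volume at \<open>b\<close>.
  That volume agrees with the Hausdorff measure up to a constant: countable subadditivity, scaling and
  dyadic cube covers bound the Hausdorff measure above by a multiple of Lebesgue measure, and complements in
  a cube give the reverse inequality, without Caratheodory's theorem.\<close>

section \<open>Hausdorff and Lebesgue measure\<close>

text \<open>The density is wanted at the single point \<open>b\<close>, so an almost-everywhere
  inversion theorem says too little, and the restricted weight may jump at the ends of the
  intervals. The limit is therefore computed in coordinates \<open>x0 + L y + R v\<close> adapted to
  the slice: only the transversal variable \<open>v\<close> shrinks with the width of the Gaussian,
  while \<open>y\<close> runs along the slice. Integrability is borderline. Each column contributes
  a factor decaying like one over \<open>\<eta> \<bullet> column j A\<close>, and m independent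
  columns give just the exponent 1 at which the integral over \<eta> diverges logarithmically.
  Distributing the product over column bases that each avoid one column raises the exponent to n /
  (n - 1). All constants (Jacobian, powers of 2 pi, value of the weight on the slice, ratio of
  Hausdorff to Lebesgue measure) are fixed before the box is chosen. They cancel in the quotients,
  so it suffices to know that they are positive and finite.\<close>

definition fine_covers :: "real \<Rightarrow> 'a::metric_space set \<Rightarrow> (nat \<Rightarrow> 'a set) set" where
  "fine_covers \<delta> S = {C. S \<subseteq> (\<Union>i. C i) \<and> (\<forall>i. bounded (C i) \<and> diameter (C i) \<le> \<delta>)}"

definition hausdorff_pre :: "real \<Rightarrow> real \<Rightarrow> 'a::metric_space set \<Rightarrow> ennreal" where
  "hausdorff_pre s \<delta> S = (INF C\<in>fine_covers \<delta> S. \<Sum>i. ennreal (diameter (C i) powr s))"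

text \<open>This is \<open>hausdorff_measure\<close> without its normalising factor, which is
  restored only in \<open>hausdorff_measure_isometry_image\<close>.\<close>

definition hausdorff_outer :: "real \<Rightarrow> 'a::metric_space set \<Rightarrow> ennreal" where
  "hausdorff_outer s S = (SUP \<delta>\<in>{0<..}. hausdorff_pre s \<delta> S)"

lemma hausdorff_measure_eq_outer:
  "hausdorff_measure s S = ennreal (pi powr (s/2) / (Gamma (s/2 + 1) * 2 powr s)) * hausdorff_outer s S"
  by (simp add: hausdorff_measure_def hausdorff_outer_def hausdorff_pre_def fine_covers_def)

lemma hausdorff_pre_le:
  assumes "C \<in> fine_covers \<delta> S"
  shows "hausdorff_pre s \<delta> S \<le> (\<Sum>i. ennreal (diameter (C i) powr s))"
  unfolding hausdorff_pre_def using assms by (rule INF_lower)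

lemma hausdorff_pre_le_outer: "0 < \<delta> \<Longrightarrow> hausdorff_pre s \<delta> S \<le> hausdorff_outer s S"
  unfolding hausdorff_outer_def by (rule SUP_upper) simp

lemma hausdorff_outer_leI: "(\<And>\<delta>. 0 < \<delta> \<Longrightarrow> hausdorff_pre s \<delta> S \<le> B) \<Longrightarrow> hausdorff_outer s S \<le> B"
  unfolding hausdorff_outer_def by (rule SUP_least) simp

lemma hausdorff_outer_mono: "S \<subseteq> T \<Longrightarrow> hausdorff_outer s S \<le> hausdorff_outer s T"
  unfolding hausdorff_outer_def hausdorff_pre_def fine_covers_def
  by (intro SUP_mono' INF_superset_mono) auto

text \<open>Near-optimal covers of the sets \<open>S i\<close>, with errors
  \<open>e * (1/2) ^ Suc i\<close> adding up to \<open>e\<close>, are merged into one sequence by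
  \<open>prod_decode\<close>. Merging keeps the scale \<delta>, so the supremum over \<delta> can be
  taken afterwards.\<close>

lemma hausdorff_pre_UN_le: "hausdorff_pre s \<delta> (\<Union>i::nat. S i) \<le> (\<Sum>i. hausdorff_pre s \<delta> (S i))"
proof (rule ennreal_le_epsilon)
  fix e :: real assume e: "0 < e" and fin: "(\<Sum>i. hausdorff_pre s \<delta> (S i)) < top"
  have "\<exists>C\<in>fine_covers \<delta> (S i). (\<Sum>n. ennreal (diameter (C n) powr s)) < hausdorff_pre s \<delta> (S i) + e * (1/2) ^ Suc i"
    for i
  proof -
    \<comment> \<open>An infinite value would not grow when the error is added, and no cover would
      lie strictly below it.\<close>
    have "hausdorff_pre s \<delta> (S i) < top"
      using fin by (metis ennreal_suminf_lessD)
    then have "hausdorff_pre s \<delta> (S i) < hausdorff_pre s \<delta> (S i) + ennreal (e * (1/2) ^ Suc i)"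
      using e by (cases "hausdorff_pre s \<delta> (S i)") (auto simp: ennreal_plus[symmetric] ennreal_less_iff simp del: ennreal_plus)
    then show ?thesis
      by (subst (asm) hausdorff_pre_def) (simp only: INF_less_iff hausdorff_pre_def)
  qed
  then obtain C where C: "\<And>i. C i \<in> fine_covers \<delta> (S i)"
    "\<And>i. (\<Sum>n. ennreal (diameter (C i n) powr s)) < hausdorff_pre s \<delta> (S i) + e * (1/2) ^ Suc i"
    by metis
  let ?B = "\<lambda>k. case prod_decode k of (i, n) \<Rightarrow> C i n"
  have "?B \<in> fine_covers \<delta> (\<Union>i. S i)"
    unfolding fine_covers_def
  proof (intro CollectI conjI subsetI)
    fix x assume "x \<in> (\<Union>i. S i)"
    then obtain i n where "x \<in> C i n" using C(1) unfolding fine_covers_def by blast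
    then show "x \<in> (\<Union>k. ?B k)" by (intro UN_I[of "prod_encode (i, n)"]) auto
  qed (use C(1) in \<open>auto simp: fine_covers_def split: prod.split\<close>)
  then have "hausdorff_pre s \<delta> (\<Union>i. S i) \<le> (\<Sum>k. ennreal (diameter (?B k) powr s))"
    by (rule hausdorff_pre_le)
  also have "\<dots> = (\<Sum>k. (case prod_decode k of (i, n) \<Rightarrow> ennreal (diameter (C i n) powr s)))"
    by (simp add: case_prod_unfold)
  also have "\<dots> = (\<Sum>i. \<Sum>n. ennreal (diameter (C i n) powr s))"
    by (rule suminf_ennreal_2dimen[where f="\<lambda>(i, n). ennreal (diameter (C i n) powr s)"]) simp
  also have "\<dots> \<le> (\<Sum>i. hausdorff_pre s \<delta> (S i) + e * (1/2) ^ Suc i)"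
    by (intro suminf_le allI less_imp_le C) auto
  also have "\<dots> = (\<Sum>i. hausdorff_pre s \<delta> (S i)) + (\<Sum>i. ennreal e * ennreal ((1/2) ^ Suc i))"
    using \<open>0 < e\<close> by (subst suminf_add[symmetric])
      (auto simp del: ennreal_suminf_cmult simp add: ennreal_mult[symmetric])
  also have "\<dots> = (\<Sum>i. hausdorff_pre s \<delta> (S i)) + e"
    unfolding ennreal_suminf_cmult
    by (subst suminf_ennreal_eq[OF zero_le_power power_half_series]) auto
  finally show "hausdorff_pre s \<delta> (\<Union>i. S i) \<le> (\<Sum>i. hausdorff_pre s \<delta> (S i)) + e" .
qed

lemma hausdorff_outer_UN_le: "hausdorff_outer s (\<Union>i::nat. S i) \<le> (\<Sum>i. hausdorff_outer s (S i))"
proof (rule hausdorff_outer_leI)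
  fix \<delta> :: real assume "0 < \<delta>"
  have "hausdorff_pre s \<delta> (\<Union>i. S i) \<le> (\<Sum>i. hausdorff_pre s \<delta> (S i))" by (rule hausdorff_pre_UN_le)
  also have "\<dots> \<le> (\<Sum>i. hausdorff_outer s (S i))"
    using \<open>0 < \<delta>\<close> by (intro suminf_le allI hausdorff_pre_le_outer) auto
  finally show "hausdorff_pre s \<delta> (\<Union>i. S i) \<le> (\<Sum>i. hausdorff_outer s (S i))" .
qed

lemma hausdorff_outer_empty [simp]: "hausdorff_outer s {} = 0"
proof -
  have "hausdorff_outer s {} \<le> (0::ennreal)"
    by (rule hausdorff_outer_leI, rule order_trans[OF hausdorff_pre_le[of "\<lambda>_. {}"]]) (auto simp: fine_covers_def)
  then show ?thesis by simp
qed

lemma hausdorff_outer_Un_le: "hausdorff_outer s (S \<union> T) \<le> hausdorff_outer s S + hausdorff_outer s T"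
proof -
  have "hausdorff_outer s (\<Union>i::nat. binaryset S T i) \<le> (\<Sum>i. hausdorff_outer s (binaryset S T i))"
    by (rule hausdorff_outer_UN_le)
  also have "\<dots> = hausdorff_outer s S + hausdorff_outer s T"
    by (rule suminf_binaryset_eq) simp
  finally show ?thesis by (simp add: UN_binaryset_eq)
qed

section \<open>Diameters and Hausdorff measure under similarities\<close>

lemma diameter_le_dist:
  assumes "S \<noteq> {}" "\<And>x y. x \<in> S \<Longrightarrow> y \<in> S \<Longrightarrow> dist x y \<le> d"
  shows "diameter S \<le> d"
  using assms by (auto simp: diameter_def intro!: cSUP_least)

lemma diameter_similarity:
  fixes f :: "'a::metric_space \<Rightarrow> 'b::metric_space"
  assumes f: "\<And>x y. dist (f x) (f y) = r * dist x y" and r: "0 < r" and C: "bounded C"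
  shows "bounded (f ` C)" "diameter (f ` C) = r * diameter C"
proof -
  obtain x e where "\<forall>y\<in>C. dist x y \<le> e" using C unfolding bounded_def by blast
  then have "\<forall>y\<in>f ` C. dist (f x) y \<le> r * e" using r by (auto simp: f)
  then show b: "bounded (f ` C)" unfolding bounded_def by blast
  show "diameter (f ` C) = r * diameter C"
  proof (cases "C = {}")
    case False
    show ?thesis
    proof (rule antisym)
      show "diameter (f ` C) \<le> r * diameter C"
      proof (rule diameter_le_dist)
        show "dist x y \<le> r * diameter C" if "x \<in> f ` C" "y \<in> f ` C" for x y
          using that r diameter_bounded_bound[OF C] by (auto simp: f)
      qed (use False in auto)
      have "diameter C \<le> diameter (f ` C) / r"
      proof (rule diameter_le_dist)
        show "dist x y \<le> diameter (f ` C) / r" if "x \<in> C" "y \<in> C" for x y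
          using diameter_bounded_bound[OF b, of "f x" "f y"] that r by (auto simp: f field_simps)
      qed (use False in auto)
      then show "r * diameter C \<le> diameter (f ` C)"
        using r by (simp add: field_simps)
    qed
  qed (simp add: diameter_def)
qed

text \<open>Covers of \<open>S\<close> are pushed forward for the upper bound. Since
  \<open>f\<close> need not be onto, covers of the image may stick out of its range; for the lower
  bound they are pulled back to preimages, whose rescaled diameters can only be smaller. One
  statement thus serves both the scaling of cubes and the isometric embedding of the parameter space
  of the slice.\<close>

lemma hausdorff_outer_similarity:
  fixes f :: "'a::metric_space \<Rightarrow> 'b::metric_space"
  assumes f: "\<And>x y. dist (f x) (f y) = r * dist x y" and r: "0 < r" and s: "0 \<le> s"
  shows "hausdorff_outer s (f ` S) = ennreal (r powr s) * hausdorff_outer s S"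
proof (rule antisym)
  let ?k = "ennreal (r powr s)"
  have k: "?k * ennreal (r powr - s) = 1"
    using r by (simp add: ennreal_mult[symmetric] powr_add[symmetric] del: powr_minus)
  show "hausdorff_outer s (f ` S) \<le> ?k * hausdorff_outer s S"
  proof (rule hausdorff_outer_leI)
    fix \<delta> :: real assume \<delta>: "0 < \<delta>"
    \<comment> \<open>With the factor on this side the right-hand side is a bare infimum, to which
      \<open>INF_greatest\<close> applies; \<open>k\<close> cancels the factor again.\<close>
    have "ennreal (r powr - s) * hausdorff_pre s \<delta> (f ` S) \<le> hausdorff_pre s (\<delta> / r) S"
      unfolding hausdorff_pre_def[of _ _ S]
    proof (rule INF_greatest)
      fix C assume C: "C \<in> fine_covers (\<delta> / r) S"
      then have "(\<lambda>i. f ` C i) \<in> fine_covers \<delta> (f ` S)"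
        unfolding fine_covers_def
      proof (intro CollectI conjI allI)
        show "f ` S \<subseteq> (\<Union>i. f ` C i)" using C unfolding fine_covers_def by blast
        fix i
        have *: "bounded (C i)" "diameter (C i) \<le> \<delta> / r" using C by (auto simp: fine_covers_def)
        show "bounded (f ` C i)" by (rule diameter_similarity(1)[OF f r *(1)])
        show "diameter (f ` C i) \<le> \<delta>"
          using *(2) r diameter_similarity(2)[OF f r *(1)] by (simp add: field_simps)
      qed
      then have "hausdorff_pre s \<delta> (f ` S) \<le> (\<Sum>i. ennreal (diameter (f ` C i) powr s))"
        by (rule hausdorff_pre_le)
      also have "\<dots> = (\<Sum>i. ?k * ennreal (diameter (C i) powr s))"
        using C r diameter_ge_0
        by (intro suminf_cong) (auto simp: fine_covers_def diameter_similarity(2)[OF f r] powr_mult ennreal_mult)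
      finally have "hausdorff_pre s \<delta> (f ` S) \<le> ?k * (\<Sum>i. ennreal (diameter (C i) powr s))"
        by simp
      then have "ennreal (r powr - s) * hausdorff_pre s \<delta> (f ` S) \<le> ennreal (r powr - s) * (?k * (\<Sum>i. ennreal (diameter (C i) powr s)))"
        by (rule mult_left_mono) simp
      also have "\<dots> = (\<Sum>i. ennreal (diameter (C i) powr s))"
        by (simp only: mult.assoc[symmetric] mult.commute[of "ennreal (r powr - s)"] k mult_1)
      finally show "ennreal (r powr - s) * hausdorff_pre s \<delta> (f ` S) \<le> (\<Sum>i. ennreal (diameter (C i) powr s))" .
    qed
    also have "\<dots> \<le> hausdorff_outer s S" using \<delta> r by (intro hausdorff_pre_le_outer) simp
    finally have "?k * (ennreal (r powr - s) * hausdorff_pre s \<delta> (f ` S)) \<le> ?k * hausdorff_outer s S"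
      by (rule mult_left_mono) simp
    then show "hausdorff_pre s \<delta> (f ` S) \<le> ?k * hausdorff_outer s S"
      by (simp only: mult.assoc[symmetric] k mult_1)
  qed
  have "?k * hausdorff_pre s \<delta> S \<le> hausdorff_outer s (f ` S)" if \<delta>: "0 < \<delta>" for \<delta>
  proof -
    have "?k * hausdorff_pre s \<delta> S \<le> hausdorff_pre s (r * \<delta>) (f ` S)"
      unfolding hausdorff_pre_def[of _ _ "f ` S"]
    proof (rule INF_greatest)
      fix D assume D: "D \<in> fine_covers (r * \<delta>) (f ` S)"
      have sub: "f ` (f -` D i) \<subseteq> D i" for i by auto
      have inv: "bounded (f -` D i) \<and> r * diameter (f -` D i) \<le> diameter (D i)" for i
      proof
        have bD: "bounded (D i)" using D by (auto simp: fine_covers_def)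
        show b: "bounded (f -` D i)"
          unfolding bounded_two_points
        proof (intro exI ballI)
          fix x y assume "x \<in> f -` D i" "y \<in> f -` D i"
          then have "dist (f x) (f y) \<le> diameter (D i)"
            using bD by (intro diameter_bounded_bound) auto
          then show "dist x y \<le> diameter (D i) / r" using r by (simp add: f field_simps)
        qed
        have "r * diameter (f -` D i) = diameter (f ` (f -` D i))"
          using diameter_similarity(2)[OF f r b] by simp
        also have "\<dots> \<le> diameter (D i)" by (rule diameter_subset[OF sub bD])
        finally show "r * diameter (f -` D i) \<le> diameter (D i)" .
      qed
      have "(\<lambda>i. f -` D i) \<in> fine_covers \<delta> S"
        unfolding fine_covers_def
      proof (intro CollectI conjI allI)
        show "S \<subseteq> (\<Union>i. f -` D i)" using D unfolding fine_covers_def by blast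
        fix i
        have "r * diameter (f -` D i) \<le> r * \<delta>"
          using inv[of i] D by (auto simp: fine_covers_def intro: order_trans)
        then show "diameter (f -` D i) \<le> \<delta>" using r by simp
      qed (use inv in auto)
      then have "?k * hausdorff_pre s \<delta> S \<le> ?k * (\<Sum>i. ennreal (diameter (f -` D i) powr s))"
        by (intro mult_left_mono hausdorff_pre_le) auto
      also have "\<dots> = (\<Sum>i. ?k * ennreal (diameter (f -` D i) powr s))" by simp
      also have "\<dots> = (\<Sum>i. ennreal ((r * diameter (f -` D i)) powr s))"
        using r inv diameter_ge_0 by (intro suminf_cong) (auto simp: powr_mult ennreal_mult)
      also have "\<dots> \<le> (\<Sum>i. ennreal (diameter (D i) powr s))"
        using inv r s diameter_ge_0 by (intro suminf_le allI ennreal_leI powr_mono2 mult_nonneg_nonneg) auto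
      finally show "?k * hausdorff_pre s \<delta> S \<le> (\<Sum>i. ennreal (diameter (D i) powr s))" .
    qed
    also have "\<dots> \<le> hausdorff_outer s (f ` S)" using \<delta> r by (intro hausdorff_pre_le_outer) simp
    finally show ?thesis .
  qed
  then show "?k * hausdorff_outer s S \<le> hausdorff_outer s (f ` S)"
    unfolding hausdorff_outer_def[of s S] by (subst SUP_mult_left_ennreal) (auto intro!: SUP_least)
qed

text \<open>Padding with \<open>{}\<close> turns a possibly finite family into a sequence. No
  nonempty member is repeated, so when distinct members of \<open>D\<close> have disjoint interiors,
  the interiors along the sequence form a disjoint family.\<close>

lemma countable_enum_disjoint:
  assumes "countable D"
  obtains C :: "nat \<Rightarrow> 'a set" where "range C \<subseteq> insert {} D" "\<Union>D \<subseteq> (\<Union>i. C i)"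
    "\<And>i j. i \<noteq> j \<Longrightarrow> C i = C j \<Longrightarrow> C i = {}"
proof
  let ?C = "\<lambda>i. if i \<in> to_nat_on D ` D then from_nat_into D i else {}"
  show "range ?C \<subseteq> insert {} D"
    using assms by auto
  show "\<Union>D \<subseteq> (\<Union>i. ?C i)"
  proof
    fix x assume "x \<in> \<Union>D"
    then obtain K where K: "K \<in> D" "x \<in> K" by blast
    then show "x \<in> (\<Union>i. ?C i)"
      using assms by (intro UN_I[of "to_nat_on D K"]) auto
  qed
  fix i j :: nat assume "i \<noteq> j" "?C i = ?C j"
  then show "?C i = {}"
    using assms by (auto split: if_splits)
qed

section \<open>Cube covers and the comparison of the two measures\<close>

lemma cube_props:
  fixes u :: "'a::euclidean_space" and r :: real
  assumes "0 < r"
  shows "emeasure lborel (cbox u (u + r *\<^sub>R One)) = ennreal (r ^ DIM('a))"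
    and "diameter (cbox u (u + r *\<^sub>R One)) = r * norm (One::'a)"
    and "cbox u (u + r *\<^sub>R One) = (\<lambda>x. u + r *\<^sub>R x) ` cbox 0 One"
proof -
  show "emeasure lborel (cbox u (u + r *\<^sub>R One)) = ennreal (r ^ DIM('a))"
    using assms by (simp add: emeasure_lborel_cbox_eq inner_simps)
  show "diameter (cbox u (u + r *\<^sub>R One)) = r * norm (One::'a)"
    using assms by (subst diameter_cbox) (auto simp: inner_simps dist_norm)
  show "cbox u (u + r *\<^sub>R One) = (\<lambda>x. u + r *\<^sub>R x) ` cbox 0 One"
    using assms image_affinity_cbox[of r u 0 "One::'a"] by (simp add: add.commute)
qed

lemma bounded_subset_cube:
  fixes S :: "'a::euclidean_space set"
  assumes "bounded S"
  obtains B where "0 < B" "S \<subseteq> cbox (- (B *\<^sub>R One)) (B *\<^sub>R One)"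
proof -
  obtain M where M: "\<And>x. x \<in> S \<Longrightarrow> norm x \<le> M" using assms by (auto simp: bounded_iff)
  show thesis
  proof (rule that[of "max 1 M"])
    show "S \<subseteq> cbox (- (max 1 M *\<^sub>R One)) (max 1 M *\<^sub>R One)"
    proof
      fix x assume "x \<in> S"
      then have "\<bar>x \<bullet> i\<bar> \<le> max 1 M" if "i \<in> Basis" for i
        using M[of x] Basis_le_norm[OF that, of x] by linarith
      then show "x \<in> cbox (- (max 1 M *\<^sub>R One)) (max 1 M *\<^sub>R One)"
        by (fastforce simp: mem_box inner_simps abs_le_iff)
    qed
  qed simp
qed

text \<open>The gauge forces every box of \<open>covering_lemma\<close> that meets its tag in
  \<open>S\<close> into \<open>U\<close> and into a ball of radius \<open>\<delta>/2\<close>. The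
  boxes overlap only in boundaries, hence their volumes add up to at most the volume of
  \<open>U\<close>.\<close>

lemma cube_cover:
  fixes S U :: "'a::euclidean_space set"
  assumes S: "bounded S" "S \<subseteq> U" "open U" and \<delta>: "0 < \<delta>"
  obtains C :: "nat \<Rightarrow> 'a set" where "S \<subseteq> (\<Union>i. C i)"
    "\<And>i. C i = {} \<or> (\<exists>u r. 0 < r \<and> C i = cbox u (u + r *\<^sub>R One))"
    "\<And>i. diameter (C i) \<le> \<delta>" "(\<Sum>i. emeasure lborel (C i)) \<le> emeasure lborel U"
proof -
  obtain B where B: "0 < B" "S \<subseteq> cbox (- (B *\<^sub>R One)) (B *\<^sub>R One)"
    using bounded_subset_cube[OF S(1)] by metis
  let ?a = "- (B *\<^sub>R One) :: 'a" and ?b = "B *\<^sub>R One :: 'a"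
  let ?g = "\<lambda>x. (if x \<in> U then U else UNIV) \<inter> ball x (\<delta>/2)"
  have ga: "gauge ?g"
    using S(3) \<delta> by (auto simp: gauge_def)
  have ne: "box ?a ?b \<noteq> {}"
    using B(1) by (auto simp: box_ne_empty inner_simps)
  obtain D where D: "countable D" "\<Union>D \<subseteq> cbox ?a ?b"
    "\<And>K. K \<in> D \<Longrightarrow> interior K \<noteq> {} \<and> (\<exists>c d. K = cbox c d)"
    "pairwise (\<lambda>A B. interior A \<inter> interior B = {}) D"
    "\<And>K. K \<in> D \<Longrightarrow> \<exists>x \<in> S \<inter> K. K \<subseteq> ?g x"
    "\<And>u v. cbox u v \<in> D \<Longrightarrow> \<exists>n. \<forall>i \<in> Basis. v \<bullet> i - u \<bullet> i = (?b \<bullet> i - ?a \<bullet> i) / 2^n"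
    "S \<subseteq> \<Union>D"
    by (rule covering_lemma[OF B(2) ne ga]) (rule that)
  obtain C :: "nat \<Rightarrow> 'a set" where C: "range C \<subseteq> insert {} D" "\<Union>D \<subseteq> (\<Union>i. C i)"
    "\<And>i j. i \<noteq> j \<Longrightarrow> C i = C j \<Longrightarrow> C i = {}"
    using countable_enum_disjoint[OF D(1)] by metis
  have cube: "\<exists>u r. 0 < r \<and> K = cbox u (u + r *\<^sub>R One)" if K: "K \<in> D" for K
  proof -
    obtain c d where cd: "K = cbox c d" using D(3)[OF K] by blast
    then obtain n where n: "\<And>i. i \<in> Basis \<Longrightarrow> d \<bullet> i - c \<bullet> i = (?b \<bullet> i - ?a \<bullet> i) / 2^n"
      using D(6) K by blast
    \<comment> \<open>The bounding box is itself a cube of side \<open>2 * B\<close>, so dyadic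
      subdivision yields equal sides in all directions.\<close>
    have "d = c + (2 * B / 2^n) *\<^sub>R One"
    proof (rule euclidean_eqI)
      fix i :: 'a assume i: "i \<in> Basis"
      have "d \<bullet> i - c \<bullet> i = 2 * B / 2^n" using n[OF i] i by simp
      then show "d \<bullet> i = (c + (2 * B / 2^n) *\<^sub>R One) \<bullet> i" using i by (simp add: inner_add_left)
    qed
    then show ?thesis using cd B(1) by (intro exI[of _ c] exI[of _ "2 * B / 2^n"]) simp
  qed
  have CD: "C i \<in> D" if "C i \<noteq> {}" for i using C(1) that by auto
  show thesis
  proof (rule that)
    show "S \<subseteq> (\<Union>i. C i)" using D(7) C(2) by (rule subset_trans)
    show Ccube: "C i = {} \<or> (\<exists>u r. 0 < r \<and> C i = cbox u (u + r *\<^sub>R One))" for i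
    proof (cases "C i = {}")
      case False
      show ?thesis using cube[OF CD[OF False]] by (rule disjI2)
    qed (rule disjI1)
    show "diameter (C i) \<le> \<delta>" for i
    proof (cases "C i = {}")
      case True then show ?thesis using \<delta> by (simp add: diameter_def)
    next
      case False
      obtain x where "C i \<subseteq> ball x (\<delta>/2)" using D(5)[OF CD[OF False]] by auto
      then have "diameter (C i) \<le> diameter (ball x (\<delta>/2))" by (rule diameter_subset) simp
      also have "\<dots> \<le> \<delta>" using \<delta> by (simp add: diameter_ball)
      finally show ?thesis .
    qed
    \<comment> \<open>Closed cubes may share faces; their interiors are disjoint and have the same
      volume.\<close>
    have int: "emeasure lborel (C i) = emeasure lborel (interior (C i))" for i
      using Ccube[of i]
    proof
      assume "\<exists>u r. 0 < r \<and> C i = cbox u (u + r *\<^sub>R One)"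
      then show ?thesis
        by (auto simp: interior_cbox emeasure_lborel_cbox_eq emeasure_lborel_box_eq)
    qed simp
    have sub: "C i \<subseteq> U" for i
    proof (cases "C i = {}")
      case False
      then show ?thesis using D(5)[OF CD[OF False]] S(2) by (auto split: if_splits)
    qed simp
    have "disjoint_family (\<lambda>i. interior (C i))"
      unfolding disjoint_family_on_def
    proof (intro ballI impI)
      fix i j :: nat assume ij: "i \<noteq> j"
      show "interior (C i) \<inter> interior (C j) = {}"
      proof (cases "C i = {} \<or> C j = {}")
        case False
        then have "C i \<in> D" "C j \<in> D" "C i \<noteq> C j" using CD C(3)[OF ij] by auto
        then show ?thesis using D(4) by (auto simp: pairwise_def)
      qed auto
    qed
    then have "(\<Sum>i. emeasure lborel (interior (C i))) = emeasure lborel (\<Union>i. interior (C i))"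
      by (intro suminf_emeasure) auto
    also have "\<dots> \<le> emeasure lborel U"
      using sub interior_subset S(3) by (intro emeasure_mono) (fastforce, simp)
    finally show "(\<Sum>i. emeasure lborel (C i)) \<le> emeasure lborel U"
      by (simp only: int)
  qed
qed

text \<open>A cube of side r has diameter \<open>r * norm One\<close>, which explains the constant.
  It is not the exact ratio; the bound is there to make the outer measure of the unit cube
  finite.\<close>

lemma hausdorff_outer_le_open_crude:
  fixes S U :: "'a::euclidean_space set"
  assumes "bounded S" "S \<subseteq> U" "open U"
  shows "hausdorff_outer DIM('a) S \<le> ennreal (norm (One::'a) ^ DIM('a)) * emeasure lborel U"
proof (rule hausdorff_outer_leI)
  fix \<delta> :: real assume "0 < \<delta>"
  obtain C :: "nat \<Rightarrow> 'a set" where C: "S \<subseteq> (\<Union>i. C i)"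
    "\<And>i. C i = {} \<or> (\<exists>u r. 0 < r \<and> C i = cbox u (u + r *\<^sub>R One))"
    "\<And>i. diameter (C i) \<le> \<delta>" "(\<Sum>i. emeasure lborel (C i)) \<le> emeasure lborel U"
    using cube_cover[OF assms \<open>0 < \<delta>\<close>] by blast
  have "bounded (C i)" for i using C(2)[of i] by auto
  then have "hausdorff_pre DIM('a) \<delta> S \<le> (\<Sum>i. ennreal (diameter (C i) powr DIM('a)))"
    using C by (intro hausdorff_pre_le) (auto simp: fine_covers_def)
  also have "\<dots> \<le> (\<Sum>i. ennreal (norm (One::'a) ^ DIM('a)) * emeasure lborel (C i))"
  proof (intro suminf_le allI)
    fix i show "ennreal (diameter (C i) powr DIM('a)) \<le> ennreal (norm (One::'a) ^ DIM('a)) * emeasure lborel (C i)"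
      using C(2)[of i]
    proof
      assume "\<exists>u r. 0 < r \<and> C i = cbox u (u + r *\<^sub>R One)"
      then obtain u r where r: "0 < r" "C i = cbox u (u + r *\<^sub>R One)" by blast
      have "(r * norm (One::'a)) powr DIM('a) = norm (One::'a) ^ DIM('a) * r ^ DIM('a)"
        using r(1) by (simp add: powr_realpow power_mult_distrib)
      then show ?thesis using r by (simp add: cube_props(1,2) ennreal_mult)
    qed (simp add: diameter_def)
  qed auto
  also have "\<dots> \<le> ennreal (norm (One::'a) ^ DIM('a)) * emeasure lborel U"
    using C(4) by (simp add: mult_left_mono)
  finally show "hausdorff_pre DIM('a) \<delta> S \<le> ennreal (norm (One::'a) ^ DIM('a)) * emeasure lborel U" .
qed

lemma hausdorff_outer_cube:
  fixes u :: "'a::euclidean_space"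
  assumes "0 < r"
  shows "hausdorff_outer DIM('a) (cbox u (u + r *\<^sub>R One)) = hausdorff_outer DIM('a) (cbox 0 (One::'a)) * emeasure lborel (cbox u (u + r *\<^sub>R One))"
proof -
  have "hausdorff_outer DIM('a) (cbox u (u + r *\<^sub>R One)) = ennreal (r powr DIM('a)) * hausdorff_outer DIM('a) (cbox 0 (One::'a))"
    unfolding cube_props(3)[OF assms]
    using assms by (intro hausdorff_outer_similarity) (auto simp: dist_norm simp flip: scaleR_diff_right)
  then show ?thesis
    using assms by (simp only: cube_props(1) powr_realpow mult.commute)
qed

text \<open>Each cube of the cover now contributes exactly its volume times the outer measure of the
  unit cube, and subadditivity replaces the estimate by diameters. This produces the exact constant;
  the scale 1 of the cover is arbitrary.\<close>

lemma hausdorff_outer_le_lborel_open: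
  fixes S U :: "'a::euclidean_space set"
  assumes "bounded S" "S \<subseteq> U" "open U"
  shows "hausdorff_outer DIM('a) S \<le> hausdorff_outer DIM('a) (cbox 0 (One::'a)) * emeasure lborel U"
proof -
  obtain C :: "nat \<Rightarrow> 'a set" where C: "S \<subseteq> (\<Union>i. C i)"
    "\<And>i. C i = {} \<or> (\<exists>u r. 0 < r \<and> C i = cbox u (u + r *\<^sub>R One))"
    "(\<Sum>i. emeasure lborel (C i)) \<le> emeasure lborel U"
    using cube_cover[OF assms zero_less_one] by metis
  have "hausdorff_outer DIM('a) S \<le> hausdorff_outer DIM('a) (\<Union>i. C i)" by (rule hausdorff_outer_mono[OF C(1)])
  also have "\<dots> \<le> (\<Sum>i. hausdorff_outer DIM('a) (C i))" by (rule hausdorff_outer_UN_le)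
  also have "\<dots> = (\<Sum>i. hausdorff_outer DIM('a) (cbox 0 (One::'a)) * emeasure lborel (C i))"
  proof (rule suminf_cong)
    fix i show "hausdorff_outer DIM('a) (C i) = hausdorff_outer DIM('a) (cbox 0 (One::'a)) * emeasure lborel (C i)"
      using C(2)[of i]
    proof
      assume "\<exists>u r. 0 < r \<and> C i = cbox u (u + r *\<^sub>R One)"
      then obtain u r where r: "0 < r" "C i = cbox u (u + r *\<^sub>R One)" by blast
      show ?thesis unfolding r(2) by (rule hausdorff_outer_cube[OF r(1)])
    qed simp
  qed
  also have "\<dots> \<le> hausdorff_outer DIM('a) (cbox 0 (One::'a)) * emeasure lborel U"
    using C(3) by (simp add: mult_left_mono)
  finally show ?thesis .
qed

lemma hausdorff_outer_unit_cube_finite: "hausdorff_outer DIM('a) (cbox 0 (One::'a::euclidean_space)) < \<infinity>"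
proof -
  obtain a b :: 'a where "cbox 0 One \<subseteq> box a b"
    using bounded_subset_box_symmetric[OF bounded_cbox] by metis
  then have "hausdorff_outer DIM('a) (cbox 0 (One::'a)) \<le> ennreal (norm (One::'a) ^ DIM('a)) * emeasure lborel (box a b)"
    by (intro hausdorff_outer_le_open_crude) auto
  also have "\<dots> < \<infinity>"
    using emeasure_lborel_box_finite[of a b] by (simp add: ennreal_mult_less_top)
  finally show ?thesis .
qed

text \<open>A nonempty set of diameter d lies in a cube of side \<open>2 * d\<close> centred at one
  of its points, so its volume is at most \<open>2 ^ DIM('a)\<close> times its diameter power. The
  volumes of a cover of the unit cube sum to at least 1, which bounds every cover sum below by
  \<open>(1/2) ^ DIM('a)\<close>.\<close>

lemma hausdorff_outer_unit_cube_pos: "0 < hausdorff_outer DIM('a) (cbox 0 (One::'a::euclidean_space))"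
proof -
  let ?Q = "cbox 0 (One::'a)"
  have "ennreal ((1/2) ^ DIM('a)) \<le> hausdorff_pre DIM('a) 1 ?Q"
    unfolding hausdorff_pre_def
  proof (rule INF_greatest)
    fix C assume C: "C \<in> fine_covers 1 ?Q"
    then have bC: "bounded (C i)" for i by (simp add: fine_covers_def)
    have "1 = emeasure lborel ?Q" by (simp add: emeasure_lborel_cbox_eq)
    \<comment> \<open>The covering sets are arbitrary; taking closures makes them measurable and
      keeps their diameters.\<close>
    also have "\<dots> \<le> emeasure lborel (\<Union>i. closure (C i))"
      using C closure_subset by (intro emeasure_mono) (auto simp: fine_covers_def, blast)
    also have "\<dots> \<le> (\<Sum>i. emeasure lborel (closure (C i)))"
      by (intro emeasure_subadditive_countably) auto
    also have "\<dots> \<le> (\<Sum>i. ennreal (2 ^ DIM('a)) * ennreal (diameter (C i) powr DIM('a)))"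
    proof (intro suminf_le allI)
      fix i
      show "emeasure lborel (closure (C i)) \<le> ennreal (2 ^ DIM('a)) * ennreal (diameter (C i) powr DIM('a))"
      proof (cases "C i = {}")
        case False
        then obtain x where x: "x \<in> closure (C i)" using closure_subset by auto
        let ?d = "diameter (C i)"
        have d: "0 \<le> ?d" by (rule diameter_ge_0[OF bC])
        have "closure (C i) \<subseteq> cbox (x - ?d *\<^sub>R One) (x + ?d *\<^sub>R One)"
        proof
          fix y assume "y \<in> closure (C i)"
          then have "dist y x \<le> ?d"
            using diameter_bounded_bound[of "closure (C i)" y x] x bC[of i] bounded_closure[OF bC[of i]] by (simp add: diameter_closure)
          then have "\<bar>(y - x) \<bullet> j\<bar> \<le> ?d" if "j \<in> Basis" for j
            using Basis_le_norm[OF that, of "y - x"] by (simp add: dist_norm)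
          then show "y \<in> cbox (x - ?d *\<^sub>R One) (x + ?d *\<^sub>R One)"
            by (fastforce simp: mem_box inner_simps abs_le_iff)
        qed
        then have "emeasure lborel (closure (C i)) \<le> emeasure lborel (cbox (x - ?d *\<^sub>R One) (x + ?d *\<^sub>R One))"
          by (intro emeasure_mono) auto
        also have "\<dots> = ennreal ((2 * ?d) ^ DIM('a))"
          using d by (simp add: emeasure_lborel_cbox_eq inner_simps)
        also have "(2 * ?d) ^ DIM('a) = 2 ^ DIM('a) * (?d powr DIM('a))"
          using d by (cases "?d = 0") (auto simp: powr_realpow power_mult_distrib)
        finally show ?thesis by (simp add: ennreal_mult)
      qed simp
    qed auto
    finally have "1 \<le> ennreal (2 ^ DIM('a)) * (\<Sum>i. ennreal (diameter (C i) powr DIM('a)))"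
      by simp
    then have "ennreal ((1/2) ^ DIM('a)) * 1 \<le> ennreal ((1/2) ^ DIM('a)) * (ennreal (2 ^ DIM('a)) * (\<Sum>i. ennreal (diameter (C i) powr DIM('a))))"
      by (rule mult_left_mono) simp
    also have "\<dots> = (\<Sum>i. ennreal (diameter (C i) powr DIM('a)))"
      by (simp add: mult.assoc[symmetric] ennreal_mult[symmetric] power_mult_distrib[symmetric])
    finally show "ennreal ((1/2) ^ DIM('a)) \<le> (\<Sum>i. ennreal (diameter (C i) powr DIM('a)))" by simp
  qed
  also have "\<dots> \<le> hausdorff_outer DIM('a) ?Q" by (rule hausdorff_pre_le_outer) simp
  finally show ?thesis by (rule less_le_trans[rotated]) simp
qed

lemma hausdorff_outer_le_lborel:
  fixes S :: "'a::euclidean_space set"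
  assumes "bounded S" "S \<in> sets borel"
  shows "hausdorff_outer DIM('a) S \<le> hausdorff_outer DIM('a) (cbox 0 (One::'a)) * emeasure lborel S"
proof (rule ennreal_le_epsilon)
  let ?c = "hausdorff_outer DIM('a) (cbox 0 (One::'a))"
  obtain c where c: "?c = ennreal c" "0 \<le> c"
    using hausdorff_outer_unit_cube_finite[where 'a='a] by (cases ?c) auto
  have cpos: "0 < c" using hausdorff_outer_unit_cube_pos[where 'a='a] c by simp
  fix e :: real assume e: "0 < e"
  \<comment> \<open>The excess \<open>e / c\<close> is chosen so that multiplication by the constant
    \<open>c\<close> returns \<open>e\<close>; this is where positivity of the unit cube's measure
    enters.\<close>
  obtain U where U: "open U" "S \<subseteq> U" "emeasure lborel (U - S) < ennreal (e / c)"
    using outer_regular_lborel[OF assms(2), of "e / c"] e cpos by (auto simp: divide_pos_pos)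
  have "hausdorff_outer DIM('a) S \<le> ?c * emeasure lborel U"
    by (rule hausdorff_outer_le_lborel_open[OF assms(1) U(2,1)])
  also have "emeasure lborel U = emeasure lborel S + emeasure lborel (U - S)"
    using U(1,2) assms(2) by (subst plus_emeasure) (auto intro!: arg_cong[where f="emeasure lborel"])
  also have "?c * \<dots> \<le> ?c * (emeasure lborel S + ennreal (e / c))"
    using U(3) by (intro mult_left_mono add_left_mono) auto
  also have "\<dots> = ?c * emeasure lborel S + e"
    using cpos e by (simp add: c distrib_left ennreal_mult[symmetric])
  finally show "hausdorff_outer DIM('a) S \<le> ?c * emeasure lborel S + e" .
qed

lemma hausdorff_outer_eq_lborel:
  fixes S :: "'a::euclidean_space set"
  assumes "bounded S" "S \<in> sets borel"
  shows "hausdorff_outer DIM('a) S = hausdorff_outer DIM('a) (cbox 0 (One::'a)) * emeasure lborel S"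
proof (rule antisym[OF hausdorff_outer_le_lborel[OF assms]])
  let ?c = "hausdorff_outer DIM('a) (cbox 0 (One::'a))"
  obtain M where M: "0 < M" "S \<subseteq> cbox (- (M *\<^sub>R One)) (M *\<^sub>R One)"
    using bounded_subset_cube[OF assms(1)] by metis
  let ?u = "- (M *\<^sub>R One) :: 'a"
  let ?Q = "cbox ?u (?u + (2 * M) *\<^sub>R One)"
  have "?u + (2 * M) *\<^sub>R One = M *\<^sub>R One"
    by (simp flip: scaleR_minus_left scaleR_add_left)
  then have SQ: "S \<subseteq> ?Q" using M(2) by simp
  \<comment> \<open>This term is subtracted from both sides at the end, and cancellation in
    \<open>ennreal\<close> requires it to be finite.\<close>
  have fin: "?c * emeasure lborel (?Q - S) < top"
  proof -
    have "emeasure lborel (?Q - S) \<le> emeasure lborel ?Q" by (rule emeasure_mono) auto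
    also have "\<dots> < top" using emeasure_lborel_cbox_finite by simp
    finally show ?thesis
      using hausdorff_outer_unit_cube_finite[where 'a='a] by (simp add: ennreal_mult_less_top)
  qed
  have "?c * emeasure lborel S + ?c * emeasure lborel (?Q - S) = ?c * emeasure lborel ?Q"
    using SQ assms(2) unfolding distrib_left[symmetric]
    by (subst plus_emeasure) (auto intro!: arg_cong[where f="\<lambda>A. ?c * emeasure lborel A"])
  also have "\<dots> = hausdorff_outer DIM('a) ?Q" using M(1) by (intro hausdorff_outer_cube[symmetric]) simp
  also have "\<dots> \<le> hausdorff_outer DIM('a) (S \<union> (?Q - S))" by (rule hausdorff_outer_mono) auto
  also have "\<dots> \<le> hausdorff_outer DIM('a) S + hausdorff_outer DIM('a) (?Q - S)" by (rule hausdorff_outer_Un_le)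
  also have "\<dots> \<le> hausdorff_outer DIM('a) S + ?c * emeasure lborel (?Q - S)"
    using assms(2) by (intro add_left_mono hausdorff_outer_le_lborel) auto
  finally show "?c * emeasure lborel S \<le> hausdorff_outer DIM('a) S"
    using less_imp_neq[OF fin] by (simp add: add.commute[of _ "?c * emeasure lborel (?Q - S)"] ennreal_add_left_cancel_le)
qed

text \<open>A similarity of ratio 1 moves the question to the parameter space, whose dimension
  equals the exponent \<open>d\<close> even if the ambient space is larger. The value of
  \<open>c\<close> stays hidden because it cancels in \<open>P_unif\<close>.\<close>

lemma hausdorff_measure_isometry_image:
  fixes f :: "'a::euclidean_space \<Rightarrow> 'b::metric_space"
  assumes f: "\<And>x y. dist (f x) (f y) = dist x y" and "d = real DIM('a)"
  shows "\<exists>c>0. \<forall>S. bounded S \<longrightarrow> S \<in> sets borel \<longrightarrow>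
     hausdorff_measure d (f ` S) = ennreal c * emeasure lborel S"
proof -
  let ?c = "hausdorff_outer DIM('a) (cbox 0 (One::'a))" and ?k = "pi powr (d/2) / (Gamma (d/2 + 1) * 2 powr d)"
  obtain c where c: "?c = ennreal c" "0 \<le> c"
    using hausdorff_outer_unit_cube_finite[where 'a='a] by (cases ?c) auto
  have cpos: "0 < c" using hausdorff_outer_unit_cube_pos[where 'a='a] c by simp
  have k: "0 < ?k" using assms(2) by (intro divide_pos_pos mult_pos_pos Gamma_real_pos) auto
  have "hausdorff_measure d (f ` S) = ennreal (?k * c) * emeasure lborel S"
    if S: "bounded S" "S \<in> sets borel" for S
    using hausdorff_outer_similarity[of f 1 d S] f hausdorff_outer_eq_lborel[OF S] k cpos assms(2)
    by (subst ennreal_mult) (auto simp: hausdorff_measure_eq_outer c mult.assoc)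
  moreover have "0 < ?k * c" using k cpos by (rule mult_pos_pos)
  ultimately show ?thesis by blast
qed

section \<open>Integrals over coordinate space and linear maps\<close>

lemma measurable_vec_lambda_PiM [measurable]:
  "(\<lambda>f. \<chi> i. f i) \<in> measurable (\<Pi>\<^sub>M i\<in>(UNIV::'n::finite set). (lborel::real measure)) borel"
  by (subst borel_measurable_euclidean_space) (auto simp: Basis_vec_def inner_axis)

lemma measurable_vec_nth [measurable]: "(\<lambda>x::real^'n. x $ i) \<in> borel_measurable borel"
  by (intro borel_measurable_continuous_onI continuous_intros)

text \<open>This carries the product integral for function spaces over to vectors, so that integrals
  of products of one-variable functions factor.\<close>

lemma lborel_vec_eq_PiM:
  "(lborel :: (real^'n) measure) = distr (\<Pi>\<^sub>M i\<in>UNIV. lborel) borel (\<lambda>f. \<chi> i. f i)"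
proof (rule lborel_eqI)
  interpret product_sigma_finite "\<lambda>_::'n. lborel :: real measure" by standard
  fix l u :: "real^'n" assume "\<And>b. b \<in> Basis \<Longrightarrow> l \<bullet> b \<le> u \<bullet> b"
  then have le: "l $ i \<le> u $ i" for i
    using axis_in_Basis_iff[of i "1::real"] by (auto simp: inner_axis dest!: meta_spec[of _ "axis i 1"])
  have "emeasure (distr (\<Pi>\<^sub>M i\<in>UNIV. lborel) borel (\<lambda>f. \<chi> i::'n. f i)) (box l u)
      = emeasure (\<Pi>\<^sub>M i\<in>(UNIV::'n set). lborel) (\<Pi>\<^sub>E i\<in>UNIV. {l $ i <..< u $ i})"
    by (subst emeasure_distr)
       (auto simp: mem_box_cart space_PiM PiE_iff intro!: arg_cong[where f="emeasure _"])
  also have "\<dots> = (\<Prod>i\<in>UNIV. ennreal (u $ i - l $ i))"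
    using le by (subst emeasure_PiM) auto
  also have "\<dots> = (\<Prod>b\<in>Basis. (u - l) \<bullet> b)"
    using le by (subst prod_ennreal) (auto simp: Basis_vec_def prod.UNION_disjoint axis_eq_axis inner_axis prod.reindex inj_on_def)
  finally show "emeasure (distr (\<Pi>\<^sub>M i\<in>UNIV. lborel) borel (\<lambda>f. \<chi> i::'n. f i)) (box l u) = (\<Prod>b\<in>Basis. (u - l) \<bullet> b)" .
qed simp

lemma
  fixes f :: "'n::finite \<Rightarrow> real \<Rightarrow> 'c::{real_normed_field,banach,second_countable_topology}"
  assumes f: "\<And>i. integrable lborel (f i)"
  shows integrable_vec_prod: "integrable lborel (\<lambda>x::real^'n. \<Prod>i\<in>UNIV. f i (x $ i))"
    and integral_vec_prod: "(LINT x|lborel. (\<Prod>i\<in>UNIV. f i ((x::real^'n) $ i))) = (\<Prod>i\<in>UNIV. LINT x|lborel. f i x)"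
proof -
  interpret product_sigma_finite "\<lambda>_::'n. lborel :: real measure" by standard
  have [measurable]: "f i \<in> borel_measurable borel" for i
    using borel_measurable_integrable[OF f] by simp
  show "integrable lborel (\<lambda>x::real^'n. \<Prod>i\<in>UNIV. f i (x $ i))"
    by (subst lborel_vec_eq_PiM, subst integrable_distr_eq) (auto intro: product_integrable_prod f)
  show "(LINT x|lborel. (\<Prod>i\<in>UNIV. f i ((x::real^'n) $ i))) = (\<Prod>i\<in>UNIV. LINT x|lborel. f i x)"
    by (subst lborel_vec_eq_PiM, subst integral_distr) (auto intro: product_integral_prod f)
qed

section \<open>Exponential and Gaussian integrals\<close>

lemma integrable_exp_neg_abs:
  assumes "0 < a"
  shows "integrable lborel (\<lambda>x::real. exp (- a * \<bar>x\<bar>))"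
proof -
  have "(\<lambda>x. exp (- a * x)) absolutely_integrable_on {0..}"
    using has_integral_exp_minus_to_infinity[OF assms, of 0]
    by (intro nonnegative_absolutely_integrable_1) (auto simp: integrable_on_def)
  then have 1: "integrable lborel (\<lambda>x. indicator {0..} x *\<^sub>R exp (- a * x))"
    unfolding set_integrable_def by (subst (asm) integrable_completion) auto
  then have 2: "integrable lborel (\<lambda>x. indicator {0..} (- x) *\<^sub>R exp (- a * - x))"
    using lborel_integrable_real_affine[OF 1, of "-1" 0] by simp
  show ?thesis
    by (rule Bochner_Integration.integrable_bound[OF Bochner_Integration.integrable_add[OF 1 2]])
       (auto simp: indicator_def)
qed

lemma integrable_exp_neg_norm:
  assumes "0 < a"
  shows "integrable lborel (\<lambda>x::real^'n. exp (- a * norm x))"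
proof (rule Bochner_Integration.integrable_bound)
  \<comment> \<open>Since the sum of the \<open>\<bar>x $ i\<bar>\<close> is at most
    \<open>CARD('n) * norm x\<close>, this rate makes the product of one-dimensional exponentials an
    upper bound.\<close>
  let ?a = "a / CARD('n)"
  have "0 < ?a" using assms by simp
  then show "integrable lborel (\<lambda>x::real^'n. \<Prod>i\<in>UNIV. exp (- ?a * \<bar>x $ i\<bar>))"
    by (intro integrable_vec_prod integrable_exp_neg_abs)
  show "AE x::real^'n in lborel. norm (exp (- a * norm x)) \<le> norm (\<Prod>i\<in>UNIV. exp (- ?a * \<bar>x $ i\<bar>))"
  proof (rule AE_I2)
    fix x :: "real^'n"
    have "(\<Sum>i\<in>UNIV. \<bar>x $ i\<bar>) \<le> (\<Sum>i\<in>(UNIV::'n set). norm x)"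
      by (intro sum_mono component_le_norm_cart)
    then have "?a * (\<Sum>i\<in>UNIV. \<bar>x $ i\<bar>) \<le> a * norm x"
      using assms mult_left_mono[of "\<Sum>i\<in>UNIV. \<bar>x $ i\<bar>" "CARD('n) * norm x" ?a] by simp
    then show "norm (exp (- a * norm x)) \<le> norm (\<Prod>i\<in>UNIV. exp (- ?a * \<bar>x $ i\<bar>))"
      by (simp add: exp_sum[symmetric] sum_negf sum_distrib_left)
  qed
qed (auto intro!: borel_measurable_continuous_onI continuous_intros)

lemma integrable_exp_gauss:
  assumes "0 < a"
  shows "integrable lborel (\<lambda>x::real^'n. exp (K * norm x - a * (norm x)\<^sup>2))"
proof (rule Bochner_Integration.integrable_bound)
  \<comment> \<open>The exponent is the maximum over s of \<open>(K + 1) * s - a * s^2\<close>,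
    found by completing the square.\<close>
  let ?C = "exp ((K + 1)\<^sup>2 / (4 * a))"
  show "integrable lborel (\<lambda>x::real^'n. ?C * exp (- 1 * norm x))"
    by (intro integrable_mult_right integrable_exp_neg_norm) simp
  have "K * s - a * s\<^sup>2 \<le> (K + 1)\<^sup>2 / (4 * a) - s" for s :: real
  proof -
    have "0 \<le> a * (s - (K + 1) / (2 * a))\<^sup>2" using assms by simp
    also have "\<dots> = a * s\<^sup>2 - (K + 1) * s + (K + 1)\<^sup>2 / (4 * a)"
      using assms by (simp add: power2_eq_square field_simps)
    finally show ?thesis by (simp add: algebra_simps)
  qed
  then show "AE x::real^'n in lborel. norm (exp (K * norm x - a * (norm x)\<^sup>2)) \<le> norm (?C * exp (- 1 * norm x))"
    by (simp add: exp_add[symmetric])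
qed (auto intro!: borel_measurable_continuous_onI continuous_intros)

lemma
  fixes t s :: real
  assumes t: "0 < t"
  shows integrable_gauss_iexp: "integrable lborel (\<lambda>x. exp (- (t\<^sup>2 * x\<^sup>2 / 2)) * iexp (x * s))"
    and integral_gauss_iexp: "(LINT x|lborel. exp (- (t\<^sup>2 * x\<^sup>2 / 2)) * iexp (x * s)) =
      complex_of_real (sqrt (2 * pi) / t * exp (- (s\<^sup>2 / (2 * t\<^sup>2))))"
proof -
  let ?f = "\<lambda>x. complex_of_real (std_normal_density x) * iexp (s / t * x)"
  have eq: "complex_of_real (exp (- (t\<^sup>2 * x\<^sup>2 / 2))) * iexp (x * s) = sqrt (2 * pi) * ?f (0 + t * x)" for x
    using t by (simp add: std_normal_density_def power_mult_distrib mult.commute flip: of_real_mult)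
  have i: "integrable lborel ?f"
    by (rule Bochner_Integration.integrable_bound[OF integrable_std_normal_moment[of 0]])
       (auto simp: norm_mult)
  show "integrable lborel (\<lambda>x. exp (- (t\<^sup>2 * x\<^sup>2 / 2)) * iexp (x * s))"
    unfolding eq using t by (intro integrable_mult_right lborel_integrable_real_affine i) simp
  have "(LINT x|lborel. ?f x) = (LINT x|std_normal_distribution. iexp (s / t * x))"
    by (subst integral_density) (auto simp: scaleR_conv_of_real)
  also have "\<dots> = exp (- ((s / t)\<^sup>2 / 2))"
    using fun_cong[OF char_std_normal_distribution, of "s / t"] by (simp add: char_def)
  finally have v: "(LINT x|lborel. ?f x) = exp (- ((s / t)\<^sup>2 / 2))" .
  have "(LINT x|lborel. ?f x) = t *\<^sub>R (LINT x|lborel. ?f (0 + t * x))"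
    using lborel_integral_real_affine[of t ?f 0] t by simp
  then have "(LINT x|lborel. ?f (0 + t * x)) = complex_of_real (exp (- ((s / t)\<^sup>2 / 2)) / t)"
    using t v by (simp add: scaleR_conv_of_real field_simps)
  then show "(LINT x|lborel. exp (- (t\<^sup>2 * x\<^sup>2 / 2)) * iexp (x * s)) =
      complex_of_real (sqrt (2 * pi) / t * exp (- (s\<^sup>2 / (2 * t\<^sup>2))))"
    unfolding eq by (simp add: power_divide mult.commute)
qed

lemma integral_gauss_iexp_vec:
  fixes s :: "real^'m"
  assumes t: "0 < t"
  shows "(LINT x|lborel. exp (- (t\<^sup>2 * (norm x)\<^sup>2 / 2)) * iexp (x \<bullet> s)) =
      complex_of_real ((sqrt (2 * pi) / t) ^ CARD('m) * exp (- ((norm s)\<^sup>2 / (2 * t\<^sup>2))))"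
proof -
  have "complex_of_real (exp (- (t\<^sup>2 * (norm x)\<^sup>2 / 2))) = (\<Prod>i\<in>UNIV. complex_of_real (exp (- (t\<^sup>2 * (x $ i)\<^sup>2 / 2))))"
    for x :: "real^'m"
    by (simp add: exp_sum[symmetric] norm_vec_def L2_set_def sum_nonneg
      sum_distrib_left sum_negf sum_divide_distrib flip: of_real_prod)
  moreover have "iexp (x \<bullet> s) = (\<Prod>i\<in>UNIV. iexp (x $ i * s $ i))" for x :: "real^'m"
    by (simp add: exp_sum[symmetric] inner_vec_def sum_distrib_left)
  ultimately have eq: "exp (- (t\<^sup>2 * (norm x)\<^sup>2 / 2)) * iexp (x \<bullet> s) =
     (\<Prod>i\<in>UNIV. exp (- (t\<^sup>2 * (x $ i)\<^sup>2 / 2)) * iexp (x $ i * s $ i))" for x :: "real^'m"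
    by (simp only: prod.distrib)
  have "(norm s)\<^sup>2 = (\<Sum>i\<in>UNIV. (s $ i)\<^sup>2)"
    by (simp add: norm_vec_def L2_set_def sum_nonneg)
  then have "exp (- ((norm s)\<^sup>2 / (2 * t\<^sup>2))) = (\<Prod>i\<in>UNIV. exp (- ((s $ i)\<^sup>2 / (2 * t\<^sup>2))))"
    by (simp add: exp_sum[symmetric] sum_negf sum_divide_distrib)
  then show ?thesis
    unfolding eq integral_vec_prod[OF integrable_gauss_iexp[OF t]] integral_gauss_iexp[OF t]
    by (simp only: of_real_prod[symmetric] prod.distrib prod_constant)
qed

section \<open>Linear changes of variables between index types\<close>

lemma distr_lborel_reindex:
  fixes \<beta> :: "'n::finite \<Rightarrow> 'a::euclidean_space"
  assumes \<beta>: "bij_betw \<beta> UNIV Basis"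
  shows "distr lborel borel (\<lambda>x. \<chi> i. x \<bullet> \<beta> i) = (lborel :: (real^'n) measure)"
proof (rule lborel_eqI[symmetric])
  have [measurable]: "(\<lambda>x::'a. \<chi> i. x \<bullet> \<beta> i) \<in> borel_measurable borel"
    by (intro borel_measurable_continuous_onI continuous_intros)
  have \<beta>B: "\<beta> i \<in> Basis" for i using \<beta> by (auto simp: bij_betw_def)
  fix l u :: "real^'n" assume "\<And>b. b \<in> Basis \<Longrightarrow> l \<bullet> b \<le> u \<bullet> b"
  then have le: "l $ i \<le> u $ i" for i
    using axis_in_Basis_iff[of i "1::real"] by (auto simp: inner_axis dest!: meta_spec[of _ "axis i 1"])
  define p :: "real^'n \<Rightarrow> 'a" where "p v = (\<Sum>i\<in>UNIV. v $ i *\<^sub>R \<beta> i)" for v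
  have p: "p v \<bullet> \<beta> j = v $ j" for v j
  proof -
    have "p v \<bullet> \<beta> j = (\<Sum>i\<in>UNIV. if i = j then v $ i else 0)"
      unfolding p_def inner_sum_left inner_scaleR_left
      using \<beta> \<beta>B by (intro sum.cong refl) (auto simp: inner_Basis bij_betw_def inj_on_def)
    then show ?thesis by simp
  qed
  have Bas: "(\<forall>b\<in>Basis. P b) \<longleftrightarrow> (\<forall>i. P (\<beta> i))" for P
    using \<beta> by (metis UNIV_I bij_betw_imp_surj_on imageE rangeI)
  have "emeasure (distr lborel borel (\<lambda>x::'a. \<chi> i. x \<bullet> \<beta> i)) (box l u) = emeasure lborel (box (p l) (p u))"
    by (subst emeasure_distr) (auto simp: mem_box_cart mem_box Bas p intro!: arg_cong[where f="emeasure _"])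
  also have "\<dots> = ennreal (\<Prod>b\<in>Basis. (p u - p l) \<bullet> b)"
    by (simp add: emeasure_lborel_box_eq Bas p le)
  also have "(\<Prod>b\<in>Basis. (p u - p l) \<bullet> b) = (\<Prod>i\<in>UNIV. u $ i - l $ i)"
    using prod.reindex_bij_betw[OF \<beta>, of "\<lambda>b. (p u - p l) \<bullet> b"] by (simp add: inner_diff_left p)
  also have "\<dots> = (\<Prod>b\<in>Basis. (u - l) \<bullet> b)"
    by (simp add: Basis_vec_def prod.UNION_disjoint axis_eq_axis inner_axis prod.reindex inj_on_def)
  finally show "emeasure (distr lborel borel (\<lambda>x::'a. \<chi> i. x \<bullet> \<beta> i)) (box l u) = (\<Prod>b\<in>Basis. (u - l) \<bullet> b)" .
qed simp

text \<open>The determinant formula for images is applied to preimages of boxes, and boxes determine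
  the measure. Expressing \<open>lborel\<close> as a constant density over an image measure lets
  integrability and integrals be transported together.\<close>

lemma lborel_linear_vec:
  fixes g :: "real^'n::{finite,wellorder} \<Rightarrow> real^'n::_"
  assumes g: "linear g" "inj g"
  shows "lborel = density (distr lborel borel g) (\<lambda>_. ennreal \<bar>det (matrix g)\<bar>)"
proof (rule lborel_eqI)
  have [measurable]: "g \<in> borel_measurable borel"
    by (intro borel_measurable_continuous_onI linear_continuous_on linear_conv_bounded_linear[THEN iffD1] g)
  obtain h where h: "linear h" "\<And>x. h (g x) = x" "\<And>x. g (h x) = x"
    using linear_injective_isomorphism[OF g] by auto
  fix l u :: "(real, 'n) vec" assume le: "\<And>b. b \<in> Basis \<Longrightarrow> l \<bullet> b \<le> u \<bullet> b"
  have S: "g -` box l u \<in> sets lborel"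
    using measurable_sets_borel[of g borel "box l u"] by simp
  have pre: "g -` box l u = h ` box l u"
  proof
    show "g -` box l u \<subseteq> h ` box l u" using h(2) by (metis image_eqI subsetI vimageE)
    show "h ` box l u \<subseteq> g -` box l u" using h(3) by auto
  qed
  have "g ` (g -` box l u) = box l u" using h(3) by (metis surj_def surj_image_vimage_eq)
  moreover have L: "g -` box l u \<in> lmeasurable"
    unfolding pre by (rule measurable_linear_image[OF h(1)]) simp
  ultimately have "measure lebesgue (box l u) = \<bar>det (matrix g)\<bar> * measure lebesgue (g -` box l u)"
    using measure_linear_image[OF g(1), of "g -` box l u"] by simp
  then have *: "measure lborel (box l u) = \<bar>det (matrix g)\<bar> * measure lborel (g -` box l u)"
    using S by (simp add: measure_completion)
  have fin: "emeasure lborel (g -` box l u) < top"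
    using L S by (simp add: fmeasurable_def)
  have "emeasure (density (distr lborel borel g) (\<lambda>_. ennreal \<bar>det (matrix g)\<bar>)) (box l u)
     = ennreal \<bar>det (matrix g)\<bar> * emeasure lborel (g -` box l u)"
    by (simp add: emeasure_density_const emeasure_distr)
  also have "\<dots> = ennreal (measure lborel (box l u))"
    using fin by (subst *) (simp add: emeasure_eq_ennreal_measure ennreal_mult)
  also have "\<dots> = (\<Prod>b\<in>Basis. (u - l) \<bullet> b)"
    using le by (simp add: measure_def emeasure_lborel_box_eq prod_nonneg inner_diff_left)
  finally show "emeasure (density (distr lborel borel g) (\<lambda>_. ennreal \<bar>det (matrix g)\<bar>)) (box l u) = (\<Prod>b\<in>Basis. (u - l) \<bullet> b)" .
qed simp

lemma lborel_coordinates: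
  assumes d: "DIM('a::euclidean_space) = CARD('n::finite)"
  obtains \<Phi> :: "'a::euclidean_space \<Rightarrow> real^'n::finite" and \<Psi> where "linear \<Phi>" "linear \<Psi>"
    "\<And>x. \<Psi> (\<Phi> x) = x" "\<And>v. \<Phi> (\<Psi> v) = v"
    "distr lborel borel \<Phi> = lborel" "distr lborel borel \<Psi> = lborel"
proof -
  obtain \<beta> :: "'n \<Rightarrow> 'a" where \<beta>: "bij_betw \<beta> UNIV Basis"
    using finite_same_card_bij[of "UNIV::'n set" "Basis::'a set"] d by auto
  have \<beta>B: "\<beta> i \<in> Basis" for i using \<beta> by (auto simp: bij_betw_def)
  let ?\<Phi> = "\<lambda>x. \<chi> i::'n. x \<bullet> \<beta> i" and ?\<Psi> = "\<lambda>v::real^'n. \<Sum>i\<in>UNIV. v $ i *\<^sub>R \<beta> i"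
  have \<Psi>: "linear ?\<Psi>"
    by (intro linear_compose_sum ballI linearI) (auto simp: scaleR_add_left)
  have \<Phi>: "linear ?\<Phi>"
    by (intro linearI) (auto simp: vec_eq_iff inner_add_left)
  have \<Psi>\<Phi>: "?\<Psi> (?\<Phi> x) = x" for x
    using sum.reindex_bij_betw[OF \<beta>, of "\<lambda>b. (x \<bullet> b) *\<^sub>R b"] by (simp add: euclidean_representation)
  have \<Phi>\<Psi>: "?\<Phi> (?\<Psi> v) = v" for v
  proof -
    have "?\<Psi> v \<bullet> \<beta> j = (\<Sum>i\<in>UNIV. if i = j then v $ i else 0)" for j
      unfolding inner_sum_left inner_scaleR_left
      using \<beta> \<beta>B by (intro sum.cong refl) (auto simp: inner_Basis bij_betw_def inj_on_def)
    then show ?thesis by (simp add: vec_eq_iff)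
  qed
  have [measurable]: "?\<Phi> \<in> borel_measurable borel" "?\<Psi> \<in> borel_measurable borel"
    by (auto intro!: borel_measurable_continuous_onI continuous_intros)
  have "distr lborel borel ?\<Psi> = distr (distr lborel borel ?\<Phi>) borel ?\<Psi>"
    by (simp add: distr_lborel_reindex[OF \<beta>])
  also have "\<dots> = distr lborel borel (\<lambda>x. x)"
    by (subst distr_distr) (auto simp only: o_def \<Psi>\<Phi>, measurable)
  also have "\<dots> = lborel" by (simp add: distr_id2)
  finally show thesis
    by (intro that[OF \<Phi> \<Psi> \<Psi>\<Phi> \<Phi>\<Psi> distr_lborel_reindex[OF \<beta>]])
qed

lemma linear_imp_borel_measurable:
  fixes f :: "'a::euclidean_space \<Rightarrow> 'b::euclidean_space"
  shows "linear f \<Longrightarrow> f \<in> borel_measurable borel"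
  by (intro borel_measurable_continuous_onI linear_continuous_on linear_conv_bounded_linear[THEN iffD1])

text \<open>A type of cardinality \<open>n - m\<close>, so that \<open>real^('n, 'm) codim\<close> can parametrise the kernel of \<open>A\<close>;
  the \<open>max 1\<close> only serves to make the representing set nonempty. The library's change of
  variables for linear maps needs a wellordered index type, and \<open>('n + unit, unit) codim\<close> is such a copy of \<open>'n\<close>.\<close>

typedef (overloaded) ('n::finite, 'm::finite) codim = "{0::nat..<max 1 (CARD('n) - CARD('m))}"
  by (auto intro!: exI[of _ 0])

instance codim :: (finite, finite) finite
proof
  have "(UNIV :: ('a, 'b) codim set) = Abs_codim ` {0..<max 1 (CARD('a) - CARD('b))}"
    by (metis type_definition.Abs_image type_definition_codim)
  then show "finite (UNIV :: ('a, 'b) codim set)" by (metis finite_atLeastLessThan finite_imageI)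
qed

instantiation codim :: (finite, finite) wellorder
begin

definition less_eq_codim where "x \<le> y \<longleftrightarrow> Rep_codim x \<le> Rep_codim y"
definition less_codim where "x < y \<longleftrightarrow> Rep_codim x < Rep_codim y"

instance
proof
  fix P :: "('a, 'b) codim \<Rightarrow> bool" and a :: "('a, 'b) codim"
  assume step: "\<And>x. (\<And>y. y < x \<Longrightarrow> P y) \<Longrightarrow> P x"
  show "P a"
    by (induction a rule: measure_induct_rule[of Rep_codim]) (auto intro: step simp: less_codim_def)
qed (auto simp: less_eq_codim_def less_codim_def Rep_codim_inject)

end

lemma card_codim: "CARD('m::finite) < CARD('n::finite) \<Longrightarrow> CARD(('n, 'm) codim) = CARD('n) - CARD('m)"
  by (simp add: type_definition.card[OF type_definition_codim])

text \<open>Measure-preserving coordinate isomorphisms conjugate \<open>f\<close> to an endomorphism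
  \<open>g\<close> over a wellordered index type; \<open>D\<close> is its absolute determinant,
  nonzero by injectivity.\<close>

lemma lborel_linear_image:
  fixes f :: "'a::euclidean_space \<Rightarrow> real^'n"
  assumes f: "linear f" "inj f" and d: "DIM('a) = CARD('n)"
  obtains D where "0 < D" "lborel = density (distr lborel borel f) (\<lambda>_. ennreal D)"
proof -
  \<comment> \<open>The cardinality is (n + 1) - 1; the added \<open>unit\<close> supplies the
    strict inequality that \<open>card_codim\<close> demands.\<close>
  have c: "CARD(('n + unit, unit) codim) = CARD('n)"
    by (subst card_codim) (simp_all add: zero_less_card_finite)
  obtain \<Phi> :: "'a \<Rightarrow> real^('n + unit, unit) codim" and \<Psi> where \<Phi>: "linear \<Phi>" "linear \<Psi>"
    "\<And>x. \<Psi> (\<Phi> x) = x" "\<And>v. \<Phi> (\<Psi> v) = v"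
    "distr lborel borel \<Phi> = lborel" "distr lborel borel \<Psi> = lborel"
    using lborel_coordinates[where 'a='a and 'n="('n + unit, unit) codim"] c d by metis
  obtain \<Theta> :: "real^'n \<Rightarrow> real^('n + unit, unit) codim" and \<Theta>' where \<Theta>: "linear \<Theta>" "linear \<Theta>'"
    "\<And>x. \<Theta>' (\<Theta> x) = x" "\<And>v. \<Theta> (\<Theta>' v) = v"
    "distr lborel borel \<Theta> = lborel" "distr lborel borel \<Theta>' = lborel"
    using lborel_coordinates[where 'a="real^'n" and 'n="('n + unit, unit) codim"] c by auto
  note [measurable] = linear_imp_borel_measurable[OF f(1)] linear_imp_borel_measurable[OF \<Phi>(1)]
    linear_imp_borel_measurable[OF \<Phi>(2)] linear_imp_borel_measurable[OF \<Theta>(1)] linear_imp_borel_measurable[OF \<Theta>(2)]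
  define g where "g = \<Theta> \<circ> (f \<circ> \<Psi>)"
  have g: "linear g" unfolding g_def by (intro linear_compose \<Theta> \<Phi> f)
  note [measurable] = linear_imp_borel_measurable[OF g]
  have "inj g" unfolding g_def
    by (intro inj_compose f(2) inj_on_inverseI[of _ \<Theta>' \<Theta>] inj_on_inverseI[of _ \<Phi> \<Psi>] \<Theta> \<Phi>)
  define D where "D = \<bar>det (matrix g)\<bar>"
  have "lborel = distr (density (distr lborel borel g) (\<lambda>_. ennreal D)) borel \<Theta>'"
    unfolding D_def lborel_linear_vec[OF g \<open>inj g\<close>, symmetric] \<Theta>(6) ..
  also have "\<dots> = density (distr (distr lborel borel g) borel \<Theta>') (\<lambda>_. ennreal D)"
    by (subst density_distr) auto
  also have "distr (distr lborel borel g) borel \<Theta>' = distr (distr (distr lborel borel \<Phi>) borel g) borel \<Theta>'"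
    by (simp only: \<Phi>(5))
  also have "\<dots> = distr lborel borel (\<lambda>x. \<Theta>' (g (\<Phi> x)))"
    by (simp add: distr_distr o_def)
  also have "(\<lambda>x. \<Theta>' (g (\<Phi> x))) = f"
    by (simp add: g_def \<Theta> \<Phi>)
  finally have "lborel = density (distr lborel borel f) (\<lambda>_. ennreal D)" .
  moreover have "0 < D"
    using g \<open>inj g\<close> by (simp add: D_def det_nz_iff_inj)
  ultimately show thesis using that by blast
qed

section \<open>Decay of Fourier transforms of boxes\<close>

lemma
  fixes z :: complex and J :: "real set"
  assumes z: "0 < Re z" and J: "J \<in> sets borel" "J \<subseteq> {0..}"
  shows integrable_exp_on: "integrable lborel (\<lambda>x::real. exp (- (z * x)) * indicator J x)"
    and exp_on_truncate: "(\<lambda>k. LINT x|lborel. exp (- (z * complex_of_real x)) * indicator (J \<inter> {..real k}) x)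
      \<longlonglongrightarrow> (LINT x|lborel. exp (- (z * complex_of_real x)) * indicator J x)"
proof -
  have le: "norm (exp (- (z * x)) * indicator S x) \<le> exp (- Re z * \<bar>x\<bar>)" if "S \<subseteq> J" for x :: real and S
    using that J(2) by (auto simp: indicator_def norm_mult)
  have [measurable]: "J \<in> sets borel" by (rule J)
  show "integrable lborel (\<lambda>x::real. exp (- (z * x)) * indicator J x)"
    by (rule Bochner_Integration.integrable_bound[OF integrable_exp_neg_abs[OF z]]) (use le in auto)
  show "(\<lambda>k. LINT x|lborel. exp (- (z * complex_of_real x)) * indicator (J \<inter> {..real k}) x)
      \<longlonglongrightarrow> (LINT x|lborel. exp (- (z * complex_of_real x)) * indicator J x)"
  proof (rule integral_dominated_convergence[where w="\<lambda>x. exp (- Re z * \<bar>x\<bar>)"])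
    show "AE x in lborel. (\<lambda>k. exp (- (z * x)) * indicator (J \<inter> {..real k}) x) \<longlonglongrightarrow> exp (- (z * x)) * indicator J x"
    proof (rule AE_I2)
      fix x :: real
      obtain N :: nat where "x \<le> N" using real_arch_simple by blast
      then have "\<forall>k\<ge>N. exp (- (z * x)) * indicator (J \<inter> {..real k}) x = exp (- (z * x)) * indicator J x"
        by (auto simp: indicator_def)
      then show "(\<lambda>k. exp (- (z * x)) * indicator (J \<inter> {..real k}) x) \<longlonglongrightarrow> exp (- (z * x)) * indicator J x"
        by (intro tendsto_eventually) (auto simp: eventually_sequentially)
    qed
  qed (use integrable_exp_neg_abs[OF z] le in auto)
qed

lemma integral_exp_Icc:
  fixes z :: complex and a c :: real
  assumes "z \<noteq> 0" "a \<le> c"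
  shows "(LINT x|lborel. exp (- (z * complex_of_real x)) * indicator {a..c} x) = (exp (- (z * a)) - exp (- (z * c))) / z"
proof -
  have "(LINT x|lborel. indicator {a..c} x *\<^sub>R exp (- (z * complex_of_real x)))
      = - exp (- (z * c)) / z - (- exp (- (z * a)) / z)"
    using assms
    by (intro integral_FTC_atLeastAtMost)
       (auto intro!: derivative_eq_intros continuous_intros simp: has_vector_derivative_complex_iff field_simps
         has_vector_derivative_def[symmetric] scaleR_conv_of_real intro: has_vector_derivative_real_field)
  also have "\<dots> = (exp (- (z * a)) - exp (- (z * c))) / z"
    by (simp add: diff_divide_distrib)
  finally show ?thesis
    by (simp add: scaleR_conv_of_real mult.commute of_real_indicator)
qed

lemma integral_exp_Ici:
  fixes z :: complex
  assumes z: "0 < Re z"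
  shows "(LINT x|lborel. exp (- (z * complex_of_real x)) * indicator {0::real..} x) = 1 / z"
proof (rule LIMSEQ_unique)
  have nz: "z \<noteq> 0" using z by auto
  show "(\<lambda>k. LINT x|lborel. exp (- (z * complex_of_real x)) * indicator ({0..} \<inter> {..real k}) x)
      \<longlonglongrightarrow> (LINT x|lborel. exp (- (z * complex_of_real x)) * indicator {0::real..} x)"
    by (rule exp_on_truncate[OF z]) auto
  have "(\<lambda>k. exp (- (z * of_real (real k)))) \<longlonglongrightarrow> 0"
  proof (rule tendsto_norm_zero_cancel)
    have "norm (exp (- z)) < 1" using z by simp
    then have "(\<lambda>k. norm (exp (- z)) ^ k) \<longlonglongrightarrow> 0" by (intro LIMSEQ_realpow_zero) auto
    then show "(\<lambda>k. norm (exp (- (z * of_real (real k))))) \<longlonglongrightarrow> 0"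
      by (simp add: exp_of_nat_mult[symmetric] mult.commute)
  qed
  then have "(\<lambda>k. (exp (- (z * of_real 0)) - exp (- (z * of_real (real k)))) / z) \<longlonglongrightarrow> (1 - 0) / z"
    using nz by (intro tendsto_intros) (auto simp del: of_real_of_nat_eq)
  moreover have "{0..} \<inter> {..real k} = {0..real k}" for k by auto
  ultimately show "(\<lambda>k. LINT x|lborel. exp (- (z * complex_of_real x)) * indicator ({0..} \<inter> {..real k}) x) \<longlonglongrightarrow> 1 / z"
    using integral_exp_Icc[OF nz, of 0] by simp
qed

text \<open>The two endpoint terms of the antiderivative have modulus at most 1, because
  \<open>Re z\<close> is positive and the endpoints are nonnegative. The bound does not depend on
  \<open>J\<close>, and truncation at \<open>k\<close> handles unbounded intervals.\<close>

lemma norm_integral_exp_interval_le: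
  fixes z :: complex and J :: "real set"
  assumes z: "0 < Re z" and J: "is_interval J" "J \<subseteq> {0..}"
  shows "norm (LINT x|lborel. exp (- (z * complex_of_real x)) * indicator J x) \<le> 2 / norm z"
proof (rule tendsto_upperbound)
  have nz: "z \<noteq> 0" using z by auto
  show "((\<lambda>k. norm (LINT x|lborel. exp (- (z * complex_of_real x)) * indicator (J \<inter> {..real k}) x))
      \<longlongrightarrow> norm (LINT x|lborel. exp (- (z * complex_of_real x)) * indicator J x)) sequentially"
    by (intro tendsto_norm exp_on_truncate z real_interval_borel_measurable J)
  show "\<forall>\<^sub>F k in sequentially. norm (LINT x|lborel. exp (- (z * complex_of_real x)) * indicator (J \<inter> {..real k}) x) \<le> 2 / norm z"
  proof (intro always_eventually allI)
    fix k :: nat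
    let ?I = "J \<inter> {..real k}"
    show "norm (LINT x|lborel. exp (- (z * complex_of_real x)) * indicator ?I x) \<le> 2 / norm z"
    proof (cases "?I = {}")
      case False
      \<comment> \<open>The truncated interval lies between the open and the closed interval from
        \<open>a\<close> to \<open>c\<close>; whichever endpoints it contains, it differs from the
        closed one by a null set.\<close>
      define a c where "a = Inf ?I" "c = Sup ?I"
      have bdd: "bdd_below ?I" "bdd_above ?I" using J(2) by auto
      have ac: "0 \<le> a" "a \<le> c"
        using False J(2) bdd unfolding a_c_def by (auto intro!: cInf_greatest cInf_le_cSup)
      have sub: "?I \<subseteq> {a..c}"
        using cInf_lower[OF _ bdd(1)] cSup_upper[OF _ bdd(2)] by (auto simp: a_c_def)
      have mid: "x \<in> ?I" if ax: "a < x" and xc: "x < c" for x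
      proof -
        obtain u where u: "u \<in> ?I" "u < x" using ax unfolding a_c_def cInf_less_iff[OF False bdd(1)] by blast
        obtain v where v: "v \<in> ?I" "x < v" using xc unfolding a_c_def less_cSup_iff[OF False bdd(2)] by blast
        show ?thesis
          using mem_is_interval_1_I[OF J(1), of u v x] u v by auto
      qed
      have "(LINT x|lborel. exp (- (z * complex_of_real x)) * indicator ?I x) = (LINT x|lborel. exp (- (z * complex_of_real x)) * indicator {a..c} x)"
      proof (rule integral_cong_AE)
        have "AE x in lborel. x \<noteq> a" "AE x in lborel. x \<noteq> c" by (rule AE_lborel_singleton)+
        then show "AE x in lborel. exp (- (z * x)) * indicator ?I x = exp (- (z * x)) * indicator {a..c} x"
        proof eventually_elim
          case (elim x)
          then show ?case using sub mid[of x] by (cases "x \<in> {a..c}") (auto simp: indicator_def)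
        qed
      qed (use real_interval_borel_measurable[OF J(1)] in \<open>measurable\<close>)
      also have "\<dots> = (exp (- (z * a)) - exp (- (z * c))) / z"
        by (rule integral_exp_Icc[OF nz ac(2)])
      also have "norm \<dots> \<le> (norm (exp (- (z * a))) + norm (exp (- (z * c)))) / norm z"
        unfolding norm_divide by (intro divide_right_mono norm_triangle_ineq4) simp
      also have "\<dots> \<le> 2 / norm z"
      proof (intro divide_right_mono)
        have "norm (exp (- (z * a))) \<le> 1" "norm (exp (- (z * c))) \<le> 1" using z ac by simp_all
        then show "norm (exp (- (z * a))) + norm (exp (- (z * c))) \<le> 2" by linarith
      qed simp
      finally show ?thesis .
    qed simp
  qed
qed simp

text \<open>Away from its endpoints the indicator of an interval is locally constant. For empty or
  unbounded intervals \<open>Inf\<close> or \<open>Sup\<close> may be meaningless numbers, which is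
  harmless: they merely enlarge the finite set \<open>F\<close>.\<close>

lemma interval_finite_exceptions:
  fixes I :: "real set"
  assumes "is_interval I"
  obtains F where "finite F" "\<And>x. x \<notin> F \<Longrightarrow> x \<in> interior I \<or> x \<in> interior (- I)"
proof -
  have "x \<in> interior I \<or> x \<in> interior (- I)" if F: "x \<noteq> Inf I" "x \<noteq> Sup I" for x
  proof (cases "(\<exists>u\<in>I. u < x) \<and> (\<exists>v\<in>I. x < v)")
    case True
    then obtain u v where uv: "u \<in> I" "u < x" "v \<in> I" "x < v" by blast
    have "{u<..<v} \<subseteq> I"
      using mem_is_interval_1_I[OF assms uv(1,3)] by auto
    then show ?thesis using uv by (intro disjI1 interiorI[of "{u<..<v}"]) auto
  next
    case False
    show ?thesis
    proof (cases "I = {}")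
      case ne: False
      \<comment> \<open>A point not strictly between two members of \<open>I\<close> has all of
        \<open>I\<close> weakly on one side of it.\<close>
      consider "\<And>u. u \<in> I \<Longrightarrow> x \<le> u" | "\<And>v. v \<in> I \<Longrightarrow> v \<le> x" using False by force
      then show ?thesis
      proof cases
        case 1
        then have "x \<le> Inf I" using ne by (intro cInf_greatest)
        moreover have "bdd_below I" using 1 by (rule bdd_belowI)
        ultimately have "x < Inf I" "{..<Inf I} \<subseteq> - I"
          using F cInf_lower[of _ I] by (auto simp: not_le[symmetric])
        then show ?thesis by (intro disjI2 interiorI[of "{..<Inf I}"]) auto
      next
        case 2
        then have "Sup I \<le> x" using ne by (intro cSup_least)
        moreover have "bdd_above I" using 2 by (rule bdd_aboveI)
        ultimately have "Sup I < x" "{Sup I<..} \<subseteq> - I"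
          using F cSup_upper[of _ I] by (auto simp: not_le[symmetric])
        then show ?thesis by (intro disjI2 interiorI[of "{Sup I<..}"]) auto
      qed
    qed simp
  qed
  then show thesis by (intro that[of "{Inf I, Sup I}"]) auto
qed

lemma integrable_powr_decay:
  assumes p: "1 < p"
  shows "integrable lborel (\<lambda>x::real. (1 + x\<^sup>2) powr (- p / 2))"
proof -
  have "(\<lambda>x. x powr (- p)) absolutely_integrable_on {1..}"
    using has_integral_powr_to_inf[of "- p" 1] p
    by (intro nonnegative_absolutely_integrable_1) (auto simp: integrable_on_def)
  then have 0: "integrable lborel (\<lambda>x. indicator {1..} x *\<^sub>R x powr (- p))"
    unfolding set_integrable_def by (subst (asm) integrable_completion) auto
  have 1: "integrable lborel (\<lambda>x. indicator {1..} (1 + x) *\<^sub>R (1 + x) powr (- p))"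
    using lborel_integrable_real_affine[OF 0, of 1 1] by simp
  have 2: "integrable lborel (\<lambda>x. indicator {1..} (1 - x) *\<^sub>R (1 - x) powr (- p))"
    using lborel_integrable_real_affine[OF 0, of "-1" 1] by simp
  have "(1 + x\<^sup>2) powr (- p / 2) \<le> 2 powr (p / 2) * (1 + \<bar>x\<bar>) powr (- p)" for x :: real
  proof -
    \<comment> \<open>Equivalently \<open>(1 + \<bar>x\<bar>)^2 \<le> 2 * (1 + x^2)\<close>, which
      reduces the claim to two shifted copies of a pure power tail.\<close>
    have "0 \<le> (1 - \<bar>x\<bar>)\<^sup>2" by simp
    then have "(1 + \<bar>x\<bar>)\<^sup>2 / 2 \<le> 1 + x\<^sup>2" by (simp add: power2_eq_square algebra_simps)
    then have "(1 + x\<^sup>2) powr (- p / 2) \<le> ((1 + \<bar>x\<bar>)\<^sup>2 / 2) powr (- p / 2)"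
      using p by (intro powr_mono2') (auto intro!: zero_less_power)
    also have "\<dots> = ((1 + \<bar>x\<bar>) powr 2) powr (- p / 2) / 2 powr (- p / 2)"
      by (simp add: powr_divide powr_numeral)
    also have "((1 + \<bar>x\<bar>) powr 2) powr (- p / 2) = (1 + \<bar>x\<bar>) powr (- p)"
      by (subst powr_powr) simp
    also have "(1 + \<bar>x\<bar>) powr (- p) / 2 powr (- p / 2) = 2 powr (p / 2) * (1 + \<bar>x\<bar>) powr (- p)"
      by (simp add: powr_minus_divide)
    finally show ?thesis .
  qed
  moreover have "(1 + \<bar>x\<bar>) powr (- p) \<le> indicator {1..} (1 + x) *\<^sub>R (1 + x) powr (- p) + indicator {1..} (1 - x) *\<^sub>R (1 - x) powr (- p)" for x :: real
    by (cases "0 \<le> x") (auto simp: indicator_def)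
  ultimately have le: "(1 + x\<^sup>2) powr (- p / 2) \<le> 2 powr (p / 2) * (indicator {1..} (1 + x) *\<^sub>R (1 + x) powr (- p) + indicator {1..} (1 - x) *\<^sub>R (1 - x) powr (- p))" for x :: real
    by (meson order_trans mult_left_mono powr_ge_zero)
  show ?thesis
    by (rule Bochner_Integration.integrable_bound[OF integrable_mult_right[OF Bochner_Integration.integrable_add[OF 1 2], of "2 powr (p / 2)"]])
       (use le in \<open>auto intro!: AE_I2 simp: abs_of_nonneg\<close>)
qed

lemma
  fixes f :: "'a::euclidean_space \<Rightarrow> 'b::euclidean_space" and G :: "'b \<Rightarrow> 'c::{banach,second_countable_topology}"
  assumes f: "linear f" and D: "0 < D" "lborel = density (distr lborel borel f) (\<lambda>_. ennreal D)"
    and G: "G \<in> borel_measurable borel"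
  shows integrable_linear_image: "integrable lborel G \<longleftrightarrow> integrable lborel (\<lambda>x. G (f x))"
    and integral_linear_image: "integral\<^sup>L lborel G = D *\<^sub>R (LINT x|lborel. G (f x))"
proof -
  note [measurable] = G linear_imp_borel_measurable[OF f]
  have "integrable lborel G \<longleftrightarrow> integrable (density (distr lborel borel f) (\<lambda>_. ennreal D)) G"
    using D(2) by simp
  also have "\<dots> \<longleftrightarrow> integrable lborel (\<lambda>x. D *\<^sub>R G (f x))"
    using D(1) by (subst integrable_density) (auto simp: integrable_distr_eq)
  also have "\<dots> \<longleftrightarrow> integrable lborel (\<lambda>x. G (f x))"
  proof
    assume "integrable lborel (\<lambda>x. D *\<^sub>R G (f x))"
    then have "integrable lborel (\<lambda>x. (1 / D) *\<^sub>R (D *\<^sub>R G (f x)))"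
      by (rule integrable_scaleR_right)
    then show "integrable lborel (\<lambda>x. G (f x))" using D(1) by simp
  qed simp
  finally show "integrable lborel G \<longleftrightarrow> integrable lborel (\<lambda>x. G (f x))" .
  have "integral\<^sup>L lborel G = integral\<^sup>L (density (distr lborel borel f) (\<lambda>_. ennreal D)) G"
    using D(2) by simp
  also have "\<dots> = D *\<^sub>R (LINT x|lborel. G (f x))"
    using D(1) by (subst integral_density) (auto simp: integral_distr)
  finally show "integral\<^sup>L lborel G = D *\<^sub>R (LINT x|lborel. G (f x))" .
qed

text \<open>The columns other than \<open>j\<close> span, so a basis can be chosen among them and
  indexed by \<open>'m\<close>. A vector orthogonal to a whole basis vanishes, which makes the
  pairing with these columns an injective change of variables in \<eta>.\<close>

lemma column_basis_avoiding:
  fixes A :: "real^'n^'m"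
  assumes "dim {column i A | i. i \<noteq> j} = CARD('m)"
  obtains \<sigma> :: "'m \<Rightarrow> 'n" where "inj \<sigma>" "j \<notin> range \<sigma>" "inj (\<lambda>\<eta>. \<chi> i. \<eta> \<bullet> column (\<sigma> i) A)"
proof -
  let ?S = "{column i A | i. i \<noteq> j}"
  obtain B where B: "B \<subseteq> ?S" "independent B" "?S \<subseteq> span B" "card B = dim ?S"
    using basis_exists by blast
  have finB: "finite B" using B(2) independent_imp_finite by blast
  then obtain v :: "'m \<Rightarrow> real^'m" where v: "bij_betw v UNIV B"
    using finite_same_card_bij[of "UNIV::'m set" B] B(4) assms by auto
  have "\<forall>i. \<exists>k. k \<noteq> j \<and> v i = column k A" using B(1) v by (auto simp: bij_betw_def)
  then obtain \<sigma> where \<sigma>: "\<And>i. \<sigma> i \<noteq> j" "\<And>i. v i = column (\<sigma> i) A" by metis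
  have "inj \<sigma>" using v \<sigma>(2) by (auto simp: bij_betw_def inj_on_def)
  moreover have "inj (\<lambda>\<eta>. \<chi> i. \<eta> \<bullet> column (\<sigma> i) A)"
  proof (rule injI)
    fix x y :: "real^'m" assume "(\<chi> i. x \<bullet> column (\<sigma> i) A) = (\<chi> i. y \<bullet> column (\<sigma> i) A)"
    then have "(x - y) \<bullet> v i = 0" for i by (simp add: vec_eq_iff \<sigma>(2) inner_diff_left)
    then have "\<And>u. u \<in> B \<Longrightarrow> orthogonal (x - y) u"
      using v by (auto simp: bij_betw_def orthogonal_def)
    moreover have "span B = UNIV"
      using B assms dim_eq_full[of B] dim_eq_card_independent[OF B(2)] by simp
    ultimately have "orthogonal (x - y) (x - y)" using orthogonal_to_span[of "x - y" B "x - y"] by blast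
    then show "x = y" by (simp add: orthogonal_def)
  qed
  ultimately show thesis using that \<sigma>(1) by blast
qed

text \<open>For each \<open>j\<close> there is a basis of columns avoiding \<open>j\<close>, and the corresponding product of
  \<open>p\<close>-th powers is integrable for \<open>p > 1\<close>. Multiplying these over all \<open>j\<close> with \<open>p = n / (n - 1)\<close> uses each
  column with total exponent at most \<open>n\<close>.\<close>

lemma prod_le_sum_prod_powr:
  fixes \<phi> :: "'n::finite \<Rightarrow> real" and \<sigma> :: "'n \<Rightarrow> 'm::finite \<Rightarrow> 'n"
  assumes \<phi>: "\<And>k. 0 < \<phi> k" "\<And>k. \<phi> k \<le> 1" and n: "1 < CARD('n)"
    and \<sigma>: "\<And>j. inj (\<sigma> j)" "\<And>j. j \<notin> range (\<sigma> j)"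
  shows "(\<Prod>k\<in>UNIV. \<phi> k) \<le> (\<Sum>j\<in>UNIV. \<Prod>i\<in>UNIV. \<phi> (\<sigma> j i) powr (CARD('n) / (CARD('n) - 1)))"
proof -
  let ?n = "CARD('n)"
  let ?p = "?n / (?n - 1)"
  let ?P = "\<lambda>j. \<Prod>i\<in>UNIV. \<phi> (\<sigma> j i) powr ?p"
  have p: "0 \<le> ?p" using n by simp
  have \<phi>p: "0 < \<phi> k powr ?p" "\<phi> k powr ?p \<le> 1" for k
    using \<phi>[of k] p by (auto simp: powr_le1)
  have P0: "0 \<le> ?P j" for j by (intro prod_nonneg) auto
  \<comment> \<open>The left product also contains the columns outside the chosen basis; their
    factors are at most 1, so omitting them can only increase the product.\<close>
  have ge: "(\<Prod>k\<in>{k\<in>UNIV. k \<noteq> j}. \<phi> k powr ?p) \<le> ?P j" for j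
  proof -
    have "?P j = (\<Prod>k\<in>range (\<sigma> j). \<phi> k powr ?p)"
      by (simp add: prod.reindex[OF \<sigma>(1)])
    moreover have "(\<Prod>k\<in>{k\<in>UNIV. k \<noteq> j}. \<phi> k powr ?p) =
       (\<Prod>k\<in>{k\<in>UNIV. k \<noteq> j} - range (\<sigma> j). \<phi> k powr ?p) * (\<Prod>k\<in>range (\<sigma> j). \<phi> k powr ?p)"
      using \<sigma>(2)[of j] by (intro prod.subset_diff) (auto, metis rangeI)
    moreover have "(\<Prod>k\<in>{k\<in>UNIV. k \<noteq> j} - range (\<sigma> j). \<phi> k powr ?p) \<le> 1"
      using \<phi>p less_imp_le by (intro prod_le_1) auto
    ultimately show ?thesis
      using mult_right_mono[of "\<Prod>k\<in>{k\<in>UNIV. k \<noteq> j} - range (\<sigma> j). \<phi> k powr ?p" 1] P0[of j] by simp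
  qed
  have "(\<Prod>k\<in>UNIV. \<phi> k) ^ ?n = (\<Prod>k\<in>UNIV. (\<phi> k powr ?p) ^ (?n - 1))"
  proof -
    have "(\<phi> k powr ?p) ^ (?n - 1) = \<phi> k ^ ?n" for k
    proof -
      have "(\<phi> k powr ?p) ^ (?n - 1) = \<phi> k powr (?p * real (?n - 1))"
        using \<phi>(1)[of k] by (simp add: powr_realpow[symmetric] powr_powr)
      also have "?p * real (?n - 1) = real ?n" using n by (simp add: of_nat_diff field_simps)
      finally show ?thesis using \<phi>(1)[of k] by (simp add: powr_realpow)
    qed
    then show ?thesis by (simp add: prod_power_distrib)
  qed
  \<comment> \<open>The exponent n equals p * (n - 1): one p-th power of column \<open>k\<close> is
    assigned to every \<open>j\<close> different from \<open>k\<close>, and the product over such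
    pairs is regrouped by \<open>j\<close>.\<close>
  also have "\<dots> = (\<Prod>k\<in>UNIV. \<Prod>j\<in>{j\<in>UNIV. k \<noteq> j}. \<phi> k powr ?p)"
  proof (intro prod.cong refl)
    fix k :: 'n
    have "{j \<in> UNIV. k \<noteq> j} = UNIV - {k}" by auto
    then have "card {j \<in> UNIV. k \<noteq> j} = ?n - 1" by (simp add: card_Diff_singleton)
    then show "(\<phi> k powr ?p) ^ (?n - 1) = (\<Prod>j\<in>{j\<in>UNIV. k \<noteq> j}. \<phi> k powr ?p)" by simp
  qed
  also have "\<dots> = (\<Prod>j\<in>UNIV. \<Prod>k\<in>{k\<in>UNIV. k \<noteq> j}. \<phi> k powr ?p)"
    by (rule prod.swap_restrict) auto
  also have "\<dots> \<le> (\<Prod>j\<in>UNIV. ?P j)"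
    using ge by (intro prod_mono) (auto intro!: prod_nonneg)
  \<comment> \<open>A geometric mean is at most the sum; this converts a product of terms into a sum
    of integrable ones.\<close>
  also have "\<dots> \<le> (\<Prod>j\<in>(UNIV::'n set). \<Sum>j\<in>UNIV. ?P j)"
    using P0 by (intro prod_mono conjI member_le_sum) auto
  also have "\<dots> = (\<Sum>j\<in>UNIV. ?P j) ^ ?n" by simp
  finally show ?thesis
    using power_le_imp_le_base[of "\<Prod>k\<in>UNIV. \<phi> k" "?n - 1" "\<Sum>j\<in>UNIV. ?P j"] P0 n
    by (simp add: sum_nonneg)
qed

lemma integrable_prod_column_decay:
  fixes A :: "real^'n^'m"
  assumes n: "1 < CARD('n)" and col: "\<And>j. dim {column i A | i. i \<noteq> j} = CARD('m)"
  shows "integrable lborel (\<lambda>\<eta>. \<Prod>k\<in>UNIV. (1 + (\<eta> \<bullet> column k A)\<^sup>2) powr (- 1 / 2))"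
proof -
  let ?p = "CARD('n) / (CARD('n) - 1)"
  let ?\<phi> = "\<lambda>\<eta> k. (1 + (\<eta> \<bullet> column k A)\<^sup>2) powr (- 1 / 2)"
  have "\<forall>j. \<exists>\<tau>::'m \<Rightarrow> 'n. inj \<tau> \<and> j \<notin> range \<tau> \<and> inj (\<lambda>\<eta>. \<chi> i. \<eta> \<bullet> column (\<tau> i) A)"
  proof
    fix j :: 'n
    show "\<exists>\<tau>::'m \<Rightarrow> 'n. inj \<tau> \<and> j \<notin> range \<tau> \<and> inj (\<lambda>\<eta>. \<chi> i. \<eta> \<bullet> column (\<tau> i) A)"
      by (rule column_basis_avoiding[OF col, of j]) (intro exI conjI)
  qed
  from choice[OF this] obtain \<sigma> :: "'n \<Rightarrow> 'm \<Rightarrow> 'n" where \<sigma>: "\<And>j. inj (\<sigma> j)" "\<And>j. j \<notin> range (\<sigma> j)"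
    "\<And>j. inj (\<lambda>\<eta>. \<chi> i. \<eta> \<bullet> column (\<sigma> j i) A)"
    by auto
  have p: "1 < ?p" using n by (simp add: field_simps)
  have int: "integrable lborel (\<lambda>\<eta>. \<Prod>i\<in>UNIV. ?\<phi> \<eta> (\<sigma> j i) powr ?p)" for j
  proof -
    let ?f = "\<lambda>\<eta>. \<chi> i. \<eta> \<bullet> column (\<sigma> j i) A" and ?G = "\<lambda>y::real^'m. \<Prod>i\<in>UNIV. (1 + (y $ i)\<^sup>2) powr (- ?p / 2)"
    have lin: "linear ?f" by (intro linearI) (auto simp: vec_eq_iff inner_add_left)
    obtain D where D: "0 < D" "lborel = density (distr lborel borel ?f) (\<lambda>_. ennreal D)"
      using lborel_linear_image[OF lin \<sigma>(3)] by auto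
    have G: "integrable lborel ?G" by (intro integrable_vec_prod integrable_powr_decay p)
    have "integrable lborel (\<lambda>\<eta>. ?G (?f \<eta>))"
      using integrable_linear_image[OF lin D, of ?G] G borel_measurable_integrable[OF G] by simp
    then show ?thesis by (simp add: powr_powr mult.commute)
  qed
  show ?thesis
  proof (rule Bochner_Integration.integrable_bound)
    show "integrable lborel (\<lambda>\<eta>. \<Sum>j\<in>UNIV. \<Prod>i\<in>UNIV. ?\<phi> \<eta> (\<sigma> j i) powr ?p)"
      by (intro Bochner_Integration.integrable_sum int)
    show "AE \<eta> in lborel. norm (\<Prod>k\<in>UNIV. ?\<phi> \<eta> k) \<le> norm (\<Sum>j\<in>UNIV. \<Prod>i\<in>UNIV. ?\<phi> \<eta> (\<sigma> j i) powr ?p)"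
    proof (rule AE_I2)
      fix \<eta> :: "real^'m"
      have b: "0 < 1 + (\<eta> \<bullet> column k A)\<^sup>2" for k by (simp add: add_pos_nonneg)
      have "?\<phi> \<eta> k \<le> 1" for k
        using powr_mono2'[of "- 1 / 2" 1 "1 + (\<eta> \<bullet> column k A)\<^sup>2"] by simp
      moreover have "0 < ?\<phi> \<eta> k" for k using b[of k] by simp
      ultimately have "(\<Prod>k\<in>UNIV. ?\<phi> \<eta> k) \<le> (\<Sum>j\<in>UNIV. \<Prod>i\<in>UNIV. ?\<phi> \<eta> (\<sigma> j i) powr ?p)"
        using \<sigma>(1,2) n by (intro prod_le_sum_prod_powr) auto
      moreover have "0 \<le> (\<Prod>k\<in>UNIV. ?\<phi> \<eta> k)" by (intro prod_nonneg) auto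
      ultimately show "norm (\<Prod>k\<in>UNIV. ?\<phi> \<eta> k) \<le> norm (\<Sum>j\<in>UNIV. \<Prod>i\<in>UNIV. ?\<phi> \<eta> (\<sigma> j i) powr ?p)"
        by simp
    qed
  qed measurable
qed

text \<open>The constant comes from \<open>v^2 + s^2 \<ge> (min v 1)^2 * (1 + s^2)\<close>; it
  trades the dependence on \<open>v\<close> for one fixed decay profile.\<close>

lemma inverse_norm_le_decay:
  fixes v s :: real
  assumes "0 < v"
  shows "1 / norm (complex_of_real v - \<i> * complex_of_real s) \<le> 1 / min v 1 * (1 + s\<^sup>2) powr (- 1 / 2)"
proof -
  have "(min v 1)\<^sup>2 \<le> v\<^sup>2" "(min v 1)\<^sup>2 \<le> 1"
    using assms by (auto intro!: power_mono simp: power_le_one)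
  then have "(min v 1)\<^sup>2 * (1 + s\<^sup>2) \<le> v\<^sup>2 + s\<^sup>2"
    using mult_right_mono[of "(min v 1)\<^sup>2" 1 "s\<^sup>2"] by (simp add: algebra_simps)
  then have "sqrt ((min v 1)\<^sup>2 * (1 + s\<^sup>2)) \<le> sqrt (v\<^sup>2 + s\<^sup>2)" by simp
  then have "min v 1 * sqrt (1 + s\<^sup>2) \<le> sqrt (v\<^sup>2 + s\<^sup>2)"
    using assms by (simp add: real_sqrt_mult)
  then have "1 / sqrt (v\<^sup>2 + s\<^sup>2) \<le> 1 / (min v 1 * sqrt (1 + s\<^sup>2))"
    using assms by (intro divide_left_mono mult_pos_pos) (auto simp: add_pos_nonneg)
  moreover have "(1 + s\<^sup>2) powr (- 1 / 2) = 1 / sqrt (1 + s\<^sup>2)"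
    by (simp add: powr_minus_divide powr_half_sqrt)
  ultimately show ?thesis by (simp add: cmod_def)
qed

section \<open>Fourier inversion on a slice\<close>

definition prod_set :: "('n::finite \<Rightarrow> real set) \<Rightarrow> (real^'n) set" where
  "prod_set J = {x. \<forall>j. x $ j \<in> J j}"

lemma sets_prod_set:
  assumes "\<And>j. J j \<in> sets borel"
  shows "prod_set J \<in> sets borel"
proof -
  have "prod_set J = (\<Inter>j\<in>UNIV. (\<lambda>x. x $ j) -` J j)" by (auto simp: prod_set_def)
  also have "\<dots> \<in> sets borel"
    using assms by (intro sets.finite_INT measurable_sets_borel[OF measurable_vec_nth]) auto
  finally show ?thesis .
qed

lemma indicator_prod_set: "indicator (prod_set J) x = (\<Prod>j\<in>UNIV. indicator (J j) (x $ j) :: 'a::{comm_semiring_1})"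
proof (cases "x \<in> prod_set J")
  case False
  then obtain j where "x $ j \<notin> J j" by (auto simp: prod_set_def)
  then have "(\<Prod>j\<in>UNIV. indicator (J j) (x $ j) :: 'a) = 0" by (intro prod_zero bexI[of _ j]) auto
  then show ?thesis using False by simp
qed (auto simp: prod_set_def)

lemma integrable_lborel_mult:
  fixes f :: "'a::euclidean_space \<Rightarrow> real" and g :: "'b::euclidean_space \<Rightarrow> real"
  assumes f: "integrable lborel f" and g: "integrable lborel g"
  shows "integrable (lborel \<Otimes>\<^sub>M lborel) (\<lambda>p. f (fst p) * g (snd p))"
proof (rule lborel_pair.Fubini_integrable)
  have [measurable]: "f \<in> borel_measurable borel" "g \<in> borel_measurable borel"
    using f g borel_measurable_integrable by auto
  show "(\<lambda>p. f (fst p) * g (snd p)) \<in> borel_measurable (lborel \<Otimes>\<^sub>M lborel)" by measurable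
  show "integrable lborel (\<lambda>x. LINT y|lborel. norm (f (fst (x, y)) * g (snd (x, y))))"
    using f by (simp add: abs_mult)
  show "AE x in lborel. integrable lborel (\<lambda>y. f (fst (x, y)) * g (snd (x, y)))"
    using g by simp
qed

lemma integral_lborel_scaleR:
  fixes f :: "'a::euclidean_space \<Rightarrow> real"
  assumes t: "0 < t" and [measurable]: "f \<in> borel_measurable borel"
  shows "(LINT v|lborel. f v) = t ^ DIM('a) * (LINT v|lborel. f (t *\<^sub>R v))"
proof -
  have "(LINT v|lborel. f v) = (LINT v|density (distr lborel borel (\<lambda>x. 0 + t *\<^sub>R x)) (\<lambda>_. ennreal (\<bar>t\<bar>^DIM('a))). f v)"
    using t by (subst lborel_affine[of t 0]) (simp_all add: ennreal_power)
  also have "\<dots> = t ^ DIM('a) * (LINT v|lborel. f (t *\<^sub>R v))"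
    using t by (subst integral_density) (auto simp: integral_distr)
  finally show ?thesis .
qed

lemma integral_lborel_translate:
  fixes f :: "'a::euclidean_space \<Rightarrow> real"
  assumes [measurable]: "f \<in> borel_measurable borel"
  shows "(LINT x|lborel. f (c + x)) = (LINT x|lborel. f x)"
proof -
  have "(LINT x|lborel. f x) = (LINT x|distr lborel borel ((+) c). f x)"
    by (simp add: lborel_distr_plus)
  also have "\<dots> = (LINT x|lborel. f (c + x))" by (subst integral_distr) auto
  finally show ?thesis ..
qed

text \<open>\<open>L\<close> parametrises the kernel of \<open>A\<close> isometrically and
  \<open>R\<close> is a right inverse, so \<open>A\<close> maps \<open>x0 + L y + R v\<close> to
  \<open>b + v\<close>. Thus \<open>y\<close> moves along the slice and \<open>v\<close> measures
  the distance from it. \<open>L_coord\<close> says that the kernel lies in no coordinate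
  hyperplane.\<close>

locale slice =
  fixes A :: "real^'n^'m" and b :: "real^'m" and w x0 :: "real^'n"
    and L :: "real^'d \<Rightarrow> real^'n" and R :: "real^'m \<Rightarrow> real^'n"
  assumes linL: "linear L" and normL: "norm (L y) = norm y" and AL: "A *v L y = 0"
    and kerL: "A *v x = 0 \<Longrightarrow> x \<in> range L"
    and linR: "linear R" and AR: "A *v R v = v" and x0: "A *v x0 = b"
    and w_ker: "A *v x = 0 \<Longrightarrow> w \<bullet> x = 0"
    and wpos: "0 < w $ j" and L_coord: "\<exists>y. L y $ j \<noteq> 0"
    and dims: "CARD('d) + CARD('m) = CARD('n)"
begin

definition "wgt J x = exp (- (w \<bullet> x)) * indicator (prod_set J) x"

definition "wmin = Min (range (\<lambda>j. w $ j))"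

lemma wmin: "0 < wmin" "wmin \<le> w $ j"
  unfolding wmin_def using wpos by (subst Min_gr_iff; auto) (rule Min_le; auto)

definition "Rbd = (SOME r. 0 < r \<and> (\<forall>v. norm (R v) \<le> norm v * r))"

lemma Rbd: "0 < Rbd" "norm (R v) \<le> norm v * Rbd"
proof -
  have "\<exists>r. 0 < r \<and> (\<forall>v. norm (R v) \<le> norm v * r)"
    using bounded_linear.pos_bounded[of R] linR by (simp add: linear_conv_bounded_linear)
  from someI_ex[OF this] show "0 < Rbd" "norm (R v) \<le> norm v * Rbd"
    unfolding Rbd_def by auto
qed

lemma measurable_slice [measurable]:
  "L \<in> borel_measurable borel" "R \<in> borel_measurable borel"
  using linL linR by (auto intro: linear_imp_borel_measurable)

context
  fixes J :: "'n \<Rightarrow> real set"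
  assumes J: "\<And>j. is_interval (J j)" "\<And>j. J j \<subseteq> {0..}"
begin

lemma measurable_prod_set_J [measurable]: "prod_set J \<in> sets borel"
  by (intro sets_prod_set real_interval_borel_measurable J)

lemma measurable_wgt [measurable]: "wgt J \<in> borel_measurable borel"
  unfolding wgt_def[abs_def] by measurable

lemma wgt_nonneg: "0 \<le> wgt J x"
  by (simp add: wgt_def)

lemma wgt_le: "wgt J x \<le> exp (- wmin * norm x)"
proof (cases "x \<in> prod_set J")
  case True
  then have x: "0 \<le> x $ j" for j using J(2)[of j] by (auto simp: prod_set_def)
  have "wmin * norm x \<le> wmin * (\<Sum>j\<in>UNIV. \<bar>x $ j\<bar>)"
    using wmin(1) by (intro mult_left_mono norm_le_l1_cart) auto
  also have "\<dots> = (\<Sum>j\<in>UNIV. wmin * x $ j)" using x by (simp add: sum_distrib_left)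
  also have "\<dots> \<le> w \<bullet> x"
    unfolding inner_vec_def using wmin(2) x by (auto intro!: sum_mono mult_right_mono)
  finally show ?thesis using True by (simp add: wgt_def)
qed (simp add: wgt_def)

lemma integrable_wgt: "integrable lborel (wgt J)"
  by (rule Bochner_Integration.integrable_bound[OF integrable_exp_neg_norm[OF wmin(1)]])
     (use wgt_le wgt_nonneg in auto)

text \<open>The Gaussian damping makes the double integral absolutely convergent. Integrating \<eta>
  out first leaves a Gaussian kernel of width \<open>t\<close> concentrated around the slice
  \<open>A *v x = b\<close>.\<close>

lemma Fubini_gauss:
  assumes t: "0 < t"
  shows "(LINT \<eta>|lborel. complex_of_real (exp (- (t\<^sup>2 * (norm \<eta>)\<^sup>2 / 2))) *
      (LINT x|lborel. iexp (\<eta> \<bullet> (A *v x - b)) * complex_of_real (wgt J x)))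
    = complex_of_real (LINT x|lborel. wgt J x * ((sqrt (2 * pi) / t) ^ CARD('m) * exp (- ((norm (A *v x - b))\<^sup>2 / (2 * t\<^sup>2)))))"
proof -
  let ?g = "\<lambda>\<eta>::real^'m. exp (- (t\<^sup>2 * (norm \<eta>)\<^sup>2 / 2))"
  let ?F = "\<lambda>x \<eta>. complex_of_real (?g \<eta>) * (iexp (\<eta> \<bullet> (A *v x - b)) * complex_of_real (wgt J x))"
  have mA [measurable]: "(\<lambda>x. A *v x) \<in> borel_measurable borel"
    by (rule linear_imp_borel_measurable) (rule matrix_vector_mul_linear)
  have g: "integrable lborel ?g"
    using integrable_exp_gauss[of "t\<^sup>2 / 2" 0] t by simp
  have int: "integrable (lborel \<Otimes>\<^sub>M lborel) (\<lambda>(x, \<eta>). ?F x \<eta>)"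
  proof (rule Bochner_Integration.integrable_bound[OF integrable_lborel_mult[OF integrable_wgt g]])
    show "AE p in lborel \<Otimes>\<^sub>M lborel. norm (case p of (x, \<eta>) \<Rightarrow> ?F x \<eta>) \<le> norm (wgt J (fst p) * ?g (snd p))"
      by (rule AE_I2) (auto simp: norm_mult abs_mult split: prod.split)
  qed measurable
  have "(LINT \<eta>|lborel. complex_of_real (?g \<eta>) * (LINT x|lborel. iexp (\<eta> \<bullet> (A *v x - b)) * complex_of_real (wgt J x)))
      = (LINT \<eta>|lborel. LINT x|lborel. ?F x \<eta>)"
    by simp
  also have "\<dots> = (LINT x|lborel. LINT \<eta>|lborel. ?F x \<eta>)"
    by (rule lborel_pair.Fubini_integral[OF int])
  also have "\<dots> = (LINT x|lborel. complex_of_real (wgt J x) * (LINT \<eta>|lborel. complex_of_real (?g \<eta>) * iexp (\<eta> \<bullet> (A *v x - b))))"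
    by (subst integral_mult_right_zero[symmetric]) (simp add: mult_ac)
  also have "\<dots> = (LINT x|lborel. complex_of_real (wgt J x * ((sqrt (2 * pi) / t) ^ CARD('m) * exp (- ((norm (A *v x - b))\<^sup>2 / (2 * t\<^sup>2))))))"
    by (subst integral_gauss_iexp_vec[OF t]) simp
  also have "\<dots> = complex_of_real (LINT x|lborel. wgt J x * ((sqrt (2 * pi) / t) ^ CARD('m) * exp (- ((norm (A *v x - b))\<^sup>2 / (2 * t\<^sup>2)))))"
    by (rule integral_complex_of_real)
  finally show ?thesis .
qed

text \<open>\<open>L\<close> being isometric, \<open>norm y\<close> is controlled by the norm of the
  whole point plus terms in \<open>x0\<close> and \<open>v\<close>. Decay of the weight thus becomes
  decay in \<open>y\<close>, at the price of exponential growth in \<open>v\<close> that the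
  Gaussian absorbs, uniformly for \<open>\<bar>s\<bar> \<le> c\<close>.\<close>

lemma slice_dominated:
  assumes "\<bar>s\<bar> \<le> c"
  shows "wgt J (x0 + L y + R (s *\<^sub>R v)) * exp (- a * (norm v)\<^sup>2) \<le>
     exp (wmin * norm x0) * (exp (- wmin * norm y) * exp (wmin * c * Rbd * norm v - a * (norm v)\<^sup>2))"
proof -
  have "norm y = norm (L y)" by (simp add: normL)
  also have "\<dots> \<le> norm (x0 + L y + R (s *\<^sub>R v)) + norm x0 + norm (R (s *\<^sub>R v))"
    using norm_triangle_ineq4[of "x0 + L y + R (s *\<^sub>R v)" "x0 + R (s *\<^sub>R v)"] norm_triangle_ineq[of x0 "R (s *\<^sub>R v)"]
    by (simp add: algebra_simps)
  also have "norm (R (s *\<^sub>R v)) \<le> c * Rbd * norm v"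
  proof -
    have "norm (R (s *\<^sub>R v)) \<le> \<bar>s\<bar> * (norm v * Rbd)" using Rbd(2)[of "s *\<^sub>R v"] by (simp add: mult.assoc)
    also have "\<dots> \<le> c * (norm v * Rbd)" using assms Rbd(1) by (intro mult_right_mono) auto
    finally show ?thesis by (simp add: mult_ac)
  qed
  finally have "wmin * norm y \<le> wmin * (norm (x0 + L y + R (s *\<^sub>R v)) + norm x0 + c * Rbd * norm v)"
    using wmin(1) by (intro mult_left_mono) auto
  then have "exp (- wmin * norm (x0 + L y + R (s *\<^sub>R v))) \<le> exp (wmin * norm x0 - wmin * norm y + wmin * c * Rbd * norm v)"
    by (simp add: algebra_simps)
  with wgt_le[of "x0 + L y + R (s *\<^sub>R v)"]
  have "wgt J (x0 + L y + R (s *\<^sub>R v)) \<le> exp (wmin * norm x0 - wmin * norm y + wmin * c * Rbd * norm v)"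
    by linarith
  then have "wgt J (x0 + L y + R (s *\<^sub>R v)) * exp (- a * (norm v)\<^sup>2) \<le>
     exp (wmin * norm x0 - wmin * norm y + wmin * c * Rbd * norm v) * exp (- a * (norm v)\<^sup>2)"
    by (rule mult_right_mono) simp
  also have "\<dots> = exp (wmin * norm x0) * (exp (- wmin * norm y) * exp (wmin * c * Rbd * norm v - a * (norm v)\<^sup>2))"
    by (simp add: mult_exp_exp)
  finally show ?thesis .
qed

lemma integrable_slice_bound:
  assumes "0 < a"
  shows "integrable (lborel \<Otimes>\<^sub>M lborel) (\<lambda>p. exp (wmin * norm x0) *
    (exp (- wmin * norm (fst p :: real^'d)) * exp (K * norm (snd p :: real^'m) - a * (norm (snd p))\<^sup>2)))"
  by (intro integrable_mult_right integrable_lborel_mult integrable_exp_neg_norm integrable_exp_gauss wmin assms)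

lemma integrable_slice:
  assumes "0 < a"
  shows "integrable (lborel \<Otimes>\<^sub>M lborel) (\<lambda>p. wgt J (x0 + L (fst p) + R (s *\<^sub>R snd p)) * exp (- a * (norm (snd p))\<^sup>2))"
  by (rule Bochner_Integration.integrable_bound[OF integrable_slice_bound[OF assms, of "wmin * \<bar>s\<bar> * Rbd"]])
     (use slice_dominated[of s "\<bar>s\<bar>"] in \<open>auto simp: wgt_nonneg abs_mult intro!: AE_I2\<close>)

text \<open>A coordinate of \<open>x0 + L y\<close> equals a given endpoint only on a hyperplane of
  the parameter space, a proper one by \<open>L_coord\<close> and hence null. Outside these finitely
  many hyperplanes no coordinate is an endpoint, so membership in the box does not change under
  small shifts by \<open>R\<close>.\<close>

lemma AE_slice: "AE p in (lborel :: (real^'d) measure) \<Otimes>\<^sub>M (lborel :: (real^'m) measure).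
   (\<lambda>k. wgt J (x0 + L (fst p) + R ((1 / Suc k) *\<^sub>R snd p))) \<longlonglongrightarrow> wgt J (x0 + L (fst p))"
proof -
  have "\<forall>j. \<exists>F. finite F \<and> (\<forall>x. x \<notin> F \<longrightarrow> x \<in> interior (J j) \<or> x \<in> interior (- J j))"
    using interval_finite_exceptions[OF J(1)] by metis
  from choice[OF this] obtain F where F: "\<And>j. finite (F j)"
    "\<And>j x. x \<notin> F j \<Longrightarrow> x \<in> interior (J j) \<or> x \<in> interior (- J j)" by auto
  have mF [measurable]: "F j \<in> sets borel" for j using F(1) by (intro borel_closed finite_imp_closed)
  have "AE y in lborel. (x0 + L y) $ j \<noteq> c" for j c
  proof -
    obtain a where a: "\<And>y. L y $ j = a \<bullet> y"
    proof
      fix y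
      have "linear (\<lambda>y. L y $ j)"
        using linL by (auto simp: linear_iff)
      then show "L y $ j = adjoint (\<lambda>y. L y $ j) 1 \<bullet> y"
        using adjoint_works[of "\<lambda>y. L y $ j" y 1] by (simp add: inner_commute)
    qed
    then have "a \<noteq> 0" using L_coord[of j] by auto
    then have "negligible {y. a \<bullet> y = c - x0 $ j}" by (intro negligible_hyperplane) simp
    moreover have "{y. a \<bullet> y = c - x0 $ j} \<in> sets borel"
      by (intro borel_closed closed_hyperplane)
    ultimately have "{y. a \<bullet> y = c - x0 $ j} \<in> null_sets lborel"
      by (simp add: negligible_iff_null_sets null_sets_def emeasure_completion)
    then show ?thesis
      by (intro AE_I'[of "{y. a \<bullet> y = c - x0 $ j}"]) (auto simp: a algebra_simps)
  qed
  then have "AE y in lborel. \<forall>j\<in>UNIV. \<forall>c\<in>F j. (x0 + L y) $ j \<noteq> c"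
    using F(1) by (intro AE_finite_allI) auto
  then have "AE y in lborel. \<forall>j\<in>UNIV. (x0 + L y) $ j \<notin> F j"
    by eventually_elim auto
  then have "AE p in (lborel :: (real^'d) measure) \<Otimes>\<^sub>M (lborel :: (real^'m) measure). \<forall>j\<in>UNIV. (x0 + L (fst p)) $ j \<notin> F j"
    by (intro lborel_pair.AE_pair_measure) (measurable, auto)
  then show ?thesis
  proof eventually_elim
    case (elim p)
    let ?x = "x0 + L (fst p)" and ?X = "\<lambda>k. x0 + L (fst p) + R ((1 / Suc k) *\<^sub>R snd p)"
    have "(\<lambda>k. ?x + (1 / Suc k) *\<^sub>R R (snd p)) \<longlonglongrightarrow> ?x + 0 *\<^sub>R R (snd p)"
      by (intro tendsto_intros LIMSEQ_Suc lim_const_over_n)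
    then have X: "?X \<longlonglongrightarrow> ?x" using linR by (simp add: linear_scale del: of_nat_Suc)
    have "\<forall>\<^sub>F k in sequentially. ?X k $ j \<in> J j \<longleftrightarrow> ?x $ j \<in> J j" for j
    proof -
      have Xj: "(\<lambda>k. ?X k $ j) \<longlonglongrightarrow> ?x $ j" by (rule tendsto_vec_nth[OF X])
      from F(2) elim have "?x $ j \<in> interior (J j) \<or> ?x $ j \<in> interior (- J j)" by auto
      then show ?thesis
      proof
        assume i: "?x $ j \<in> interior (J j)"
        from topological_tendstoD[OF Xj open_interior this] show ?thesis
          by eventually_elim (use i interior_subset[of "J j"] in auto)
      next
        assume i: "?x $ j \<in> interior (- J j)"
        from topological_tendstoD[OF Xj open_interior this] show ?thesis
          by eventually_elim (use i interior_subset[of "- J j"] in auto)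
      qed
    qed
    then have "\<forall>\<^sub>F k in sequentially. \<forall>j\<in>UNIV. ?X k $ j \<in> J j \<longleftrightarrow> ?x $ j \<in> J j"
      by (intro eventually_ball_finite) auto
    then have "\<forall>\<^sub>F k in sequentially. (indicator (prod_set J) (?X k) :: real) = indicator (prod_set J) ?x"
      by eventually_elim (auto simp: prod_set_def indicator_def)
    then have "(\<lambda>k. indicator (prod_set J) (?X k) :: real) \<longlonglongrightarrow> indicator (prod_set J) ?x"
      by (rule tendsto_eventually)
    then show ?case unfolding wgt_def by (intro tendsto_intros X)
  qed
qed

text \<open>On the slice \<open>w \<bullet> L y = 0\<close>, so the limiting weight is the constant
  \<open>exp (- (w \<bullet> x0))\<close> on the box. The integral then splits into the slice volume
  and a full Gaussian integral in \<open>v\<close>.\<close>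

lemma slice_limit:
  "(\<lambda>k. LINT p|(lborel \<Otimes>\<^sub>M lborel). wgt J (x0 + L (fst p) + R ((1 / Suc k) *\<^sub>R snd p)) * exp (- (1/2) * (norm (snd p))\<^sup>2))
    \<longlonglongrightarrow> exp (- (w \<bullet> x0)) * sqrt (2 * pi) ^ CARD('m) * measure lborel {y. x0 + L y \<in> prod_set J}"
proof -
  let ?B = "\<lambda>p. exp (wmin * norm x0) * (exp (- wmin * norm (fst p :: real^'d)) * exp (wmin * 1 * Rbd * norm (snd p :: real^'m) - 1/2 * (norm (snd p))\<^sup>2))"
  let ?lim = "\<lambda>p::(real^'d) \<times> (real^'m). wgt J (x0 + L (fst p)) * exp (- (1/2) * (norm (snd p))\<^sup>2)"
  have lim: "(\<lambda>k. LINT p|(lborel \<Otimes>\<^sub>M lborel). wgt J (x0 + L (fst p) + R ((1 / Suc k) *\<^sub>R snd p)) * exp (- (1/2) * (norm (snd p))\<^sup>2))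
    \<longlonglongrightarrow> (LINT p|(lborel \<Otimes>\<^sub>M lborel). ?lim p)"
  proof (rule integral_dominated_convergence[where w="?B"])
    show "integrable (lborel \<Otimes>\<^sub>M lborel) ?B"
      using integrable_slice_bound[of "1/2" "wmin * 1 * Rbd"] by simp
    show "AE p in lborel \<Otimes>\<^sub>M lborel. (\<lambda>k. wgt J (x0 + L (fst p) + R ((1 / Suc k) *\<^sub>R snd p)) * exp (- (1/2) * (norm (snd p))\<^sup>2)) \<longlonglongrightarrow> ?lim p"
      using AE_slice by eventually_elim (intro tendsto_intros)
    show "AE p in lborel \<Otimes>\<^sub>M lborel. norm (wgt J (x0 + L (fst p) + R ((1 / Suc k) *\<^sub>R snd p)) * exp (- (1/2) * (norm (snd p))\<^sup>2)) \<le> ?B p" for k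
      using slice_dominated[of "1 / Suc k" 1 _ _ "1/2"] by (intro AE_I2) (simp add: wgt_nonneg abs_mult)
  qed measurable
  have int0: "integrable (lborel \<Otimes>\<^sub>M lborel) ?lim"
    using integrable_slice[of "1/2" 0] linR by (simp add: linear_0)
  have "{y. x0 + L y \<in> prod_set J} \<in> sets lborel" by measurable
  moreover have "wgt J (x0 + L y) = exp (- (w \<bullet> x0)) * indicator {y. x0 + L y \<in> prod_set J} y" for y
    using w_ker[OF AL[of y]] by (auto simp: wgt_def inner_add_right indicator_def)
  ultimately have 1: "(LINT y|lborel. wgt J (x0 + L y)) = exp (- (w \<bullet> x0)) * measure lborel {y. x0 + L y \<in> prod_set J}"
    by simp
  have "complex_of_real (LINT v|lborel. exp (- (1/2) * (norm (v::real^'m))\<^sup>2)) = (LINT v|lborel. complex_of_real (exp (- (1/2) * (norm (v::real^'m))\<^sup>2)))"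
    by (rule integral_complex_of_real[symmetric])
  also have "\<dots> = complex_of_real (sqrt (2 * pi) ^ CARD('m))"
    using integral_gauss_iexp_vec[of 1 "0::real^'m"] by simp
  finally have 2: "(LINT v|lborel. exp (- (1/2) * (norm (v::real^'m))\<^sup>2)) = sqrt (2 * pi) ^ CARD('m)"
    by (simp only: of_real_eq_iff)
  have "(LINT p|(lborel \<Otimes>\<^sub>M lborel). ?lim p) = (LINT y|lborel. LINT v|lborel. wgt J (x0 + L y) * exp (- (1/2) * (norm (v::real^'m))\<^sup>2))"
    using lborel_pair.integral_fst'[OF int0] by simp
  also have "\<dots> = exp (- (w \<bullet> x0)) * sqrt (2 * pi) ^ CARD('m) * measure lborel {y. x0 + L y \<in> prod_set J}"
    using 1 2 by simp
  finally show ?thesis using lim by simp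
qed

end

text \<open>\<open>D\<close> is the Jacobian factor of the map sending \<open>(y, v)\<close> to
  \<open>L y + R v\<close>, an isomorphism by the dimension count; it precedes \<open>J\<close> and
  \<open>t\<close>, so it is common to all boxes.\<close>

lemma slice_change_of_variables:
  obtains D where "0 < D" "\<And>J t. (\<And>j. is_interval (J j)) \<Longrightarrow> (\<And>j. J j \<subseteq> {0..}) \<Longrightarrow> 0 < t \<Longrightarrow>
    (LINT x|lborel. wgt J x * ((sqrt (2 * pi) / t) ^ CARD('m) * exp (- ((norm (A *v x - b))\<^sup>2 / (2 * t\<^sup>2)))))
    = D * sqrt (2 * pi) ^ CARD('m) * (LINT p|(lborel \<Otimes>\<^sub>M lborel). wgt J (x0 + L (fst p) + R (t *\<^sub>R snd p)) * exp (- (1/2) * (norm (snd p))\<^sup>2))"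
proof -
  let ?T = "\<lambda>p. L (fst p) + R (snd p)"
  have T: "linear ?T"
    using linL linR by (auto simp: linear_iff scaleR_add_right)
  have AT: "A *v ?T p = snd p" for p by (simp add: matrix_vector_right_distrib AL AR)
  have "inj ?T"
  proof (rule injI)
    fix p p' assume eq: "?T p = ?T p'"
    have s: "snd p = snd p'" using AT[of p] AT[of p'] eq by simp
    then have "L (fst p) = L (fst p')" using eq by simp
    then have "norm (fst p - fst p') = 0" using normL[of "fst p - fst p'"] linL by (simp add: linear_diff)
    then show "p = p'" using s by (simp add: prod_eq_iff)
  qed
  moreover have "DIM((real^'d) \<times> (real^'m)) = CARD('n)" using dims by simp
  ultimately obtain D where D: "0 < D" "lborel = density (distr lborel borel ?T) (\<lambda>_. ennreal D)"
    using lborel_linear_image[OF T] by blast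
  show thesis
  proof (rule that[OF D(1)])
    fix J :: "'n \<Rightarrow> real set" and t :: real
    assume J: "\<And>j. is_interval (J j)" "\<And>j. J j \<subseteq> {0..}" and t: "0 < t"
    have [measurable]: "wgt J \<in> borel_measurable borel" by (rule measurable_wgt) (rule J)+
    have mA [measurable]: "(\<lambda>x. A *v x) \<in> borel_measurable borel"
      by (rule linear_imp_borel_measurable) (rule matrix_vector_mul_linear)
    let ?k = "(sqrt (2 * pi) / t) ^ CARD('m)"
    let ?G = "\<lambda>x. wgt J x * (?k * exp (- ((norm (A *v x - b))\<^sup>2 / (2 * t\<^sup>2))))"
    let ?a = "1 / (2 * t\<^sup>2)"
    have "(LINT x|lborel. ?G x) = (LINT x|lborel. ?G (x0 + x))"
      by (rule integral_lborel_translate[symmetric]) measurable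
    also have "\<dots> = D *\<^sub>R (LINT p|lborel. ?G (x0 + ?T p))"
      by (rule integral_linear_image[OF T D]) measurable
    also have "\<dots> = D * ?k * (LINT p|lborel. wgt J (x0 + L (fst p) + R (1 *\<^sub>R snd p)) * exp (- ?a * (norm (snd p))\<^sup>2))"
      by (simp add: matrix_vector_right_distrib AL AR x0 algebra_simps flip: integral_mult_right_zero)
    also have "(LINT p|lborel. wgt J (x0 + L (fst p) + R (1 *\<^sub>R snd p)) * exp (- ?a * (norm (snd p))\<^sup>2))
       = (LINT p|(lborel \<Otimes>\<^sub>M lborel). wgt J (x0 + L (fst p) + R (1 *\<^sub>R snd p)) * exp (- ?a * (norm (snd p))\<^sup>2))"
      by (simp only: lborel_prod)
    also have "\<dots> = (LINT y|lborel. LINT v|lborel. wgt J (x0 + L y + R v) * exp (- ?a * (norm v)\<^sup>2))"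
      using lborel_pair.integral_fst'[OF integrable_slice[where J=J and a="?a" and s=1, OF J]] t by simp
    \<comment> \<open>Rescaling \<open>v\<close> by \<open>t\<close> turns the kernel of width
      \<open>t\<close> into a fixed Gaussian, and the factor produced cancels the power of
      \<open>t\<close> in \<open>?k\<close>.\<close>
    also have "\<dots> = (LINT y|lborel. t ^ CARD('m) * (LINT v|lborel. wgt J (x0 + L y + R (t *\<^sub>R v)) * exp (- ?a * (norm (t *\<^sub>R v))\<^sup>2)))"
    proof (rule Bochner_Integration.integral_cong[OF refl])
      fix y
      have "(\<lambda>v. wgt J (x0 + L y + R v) * exp (- ?a * (norm v)\<^sup>2)) \<in> borel_measurable borel" by measurable
      from integral_lborel_scaleR[OF t this]
      show "(LINT v|lborel. wgt J (x0 + L y + R v) * exp (- ?a * (norm v)\<^sup>2))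
        = t ^ CARD('m) * (LINT v|lborel. wgt J (x0 + L y + R (t *\<^sub>R v)) * exp (- ?a * (norm (t *\<^sub>R v))\<^sup>2))" by simp
    qed
    also have "\<dots> = t ^ CARD('m) * (LINT y|lborel. LINT v|lborel. wgt J (x0 + L y + R (t *\<^sub>R v)) * exp (- (1/2) * (norm v)\<^sup>2))"
      using t by (simp add: power_mult_distrib)
    also have "(LINT y|lborel. LINT v|lborel. wgt J (x0 + L y + R (t *\<^sub>R v)) * exp (- (1/2) * (norm v)\<^sup>2))
      = (LINT p|(lborel \<Otimes>\<^sub>M lborel). wgt J (x0 + L (fst p) + R (t *\<^sub>R snd p)) * exp (- (1/2) * (norm (snd p))\<^sup>2))"
      using lborel_pair.integral_fst'[OF integrable_slice[where J=J and a="1/2" and s=t, OF J]] by simp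
    finally show "(LINT x|lborel. ?G x) = D * sqrt (2 * pi) ^ CARD('m) * (LINT p|(lborel \<Otimes>\<^sub>M lborel). wgt J (x0 + L (fst p) + R (t *\<^sub>R snd p)) * exp (- (1/2) * (norm (snd p))\<^sup>2))"
      using t by (simp add: power_divide)
  qed
qed

end

section \<open>Transforms of boxes and cancellation of the normalising factors\<close>

definition tilt :: "real^'n^'m \<Rightarrow> real^'n \<Rightarrow> real^'m \<Rightarrow> 'n \<Rightarrow> complex" where
  "tilt A w \<eta> j = complex_of_real (w $ j) - \<i> * complex_of_real (\<eta> \<bullet> column j A)"

text \<open>This is the integral of \<open>cweight\<close> over \<open>prod_set J\<close>, kept in
  factored form so that decay can be estimated one coordinate at a time.\<close>

definition box_transform :: "real^'n^'m \<Rightarrow> real^'n \<Rightarrow> ('n \<Rightarrow> real set) \<Rightarrow> real^'m \<Rightarrow> complex" where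
  "box_transform A w J \<eta> = (\<Prod>j\<in>UNIV. LINT x|lborel. exp (- (tilt A w \<eta> j * complex_of_real x)) * indicator (J j) x)"

lemma Re_tilt: "Re (tilt A w \<eta> j) = w $ j"
  by (simp add: tilt_def)

lemma orthant_prod_set: "orthant = prod_set (\<lambda>_. {0..})"
  by (auto simp: orthant_def prod_set_def)

lemma cweight_eq_prod:
  fixes A :: "real^'n^'m"
  assumes "prod_set E \<inter> orthant = prod_set J"
  shows "indicator (prod_set E) x *\<^sub>R cweight A w \<eta> x
    = (\<Prod>j\<in>UNIV. exp (- (tilt A w \<eta> j * complex_of_real (x $ j))) * indicator (J j) (x $ j))"
proof -
  have "indicator (prod_set E) x *\<^sub>R cweight A w \<eta> x = exp (- (\<Sum>j\<in>UNIV. tilt A w \<eta> j * complex_of_real (x $ j))) * indicator (prod_set E \<inter> orthant) x"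
    by (simp add: cweight_def tilt_def indicator_inter_arith scaleR_conv_of_real of_real_indicator mult_ac)
  also have "exp (- (\<Sum>j\<in>UNIV. tilt A w \<eta> j * complex_of_real (x $ j))) = (\<Prod>j\<in>UNIV. exp (- (tilt A w \<eta> j * complex_of_real (x $ j))))"
    by (simp add: exp_sum[symmetric] sum_negf)
  also have "indicator (prod_set E \<inter> orthant) x = (\<Prod>j\<in>UNIV. indicator (J j) (x $ j) :: complex)"
    by (simp add: assms indicator_prod_set)
  finally show ?thesis by (simp add: prod.distrib)
qed

text \<open>\<open>E\<close> and \<open>J\<close> are linked only through the orthant, so the same
  statement covers the whole space, the orthant and an arbitrary box.\<close>

lemma
  fixes A :: "real^'n^'m"
  assumes w: "\<And>j. 0 < w $ j" and J: "\<And>j. is_interval (J j)" "\<And>j. J j \<subseteq> {0..}"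
    and E: "prod_set E \<inter> orthant = prod_set J"
  shows set_integrable_cweight: "set_integrable lborel (prod_set E) (cweight A w \<eta>)"
    and set_integral_cweight: "(LINT x:prod_set E|lborel. cweight A w \<eta> x) = box_transform A w J \<eta>"
proof -
  have i: "integrable lborel (\<lambda>x. exp (- (tilt A w \<eta> j * complex_of_real x)) * indicator (J j) x)" for j
    using w J by (intro integrable_exp_on real_interval_borel_measurable) (auto simp: Re_tilt)
  show "set_integrable lborel (prod_set E) (cweight A w \<eta>)"
    unfolding set_integrable_def cweight_eq_prod[OF E] by (rule integrable_vec_prod[OF i])
  show "(LINT x:prod_set E|lborel. cweight A w \<eta> x) = box_transform A w J \<eta>"
    unfolding set_lebesgue_integral_def cweight_eq_prod[OF E] box_transform_def by (rule integral_vec_prod[OF i])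
qed

lemma prod_set_UNIV: "prod_set (\<lambda>_. UNIV) = UNIV"
  by (simp add: prod_set_def)

text \<open>On the full orthant each factor of the transform is
  \<open>1 / tilt A w \<eta> j\<close>, which is finite and nonzero since \<open>tilt\<close> has
  positive real part.\<close>

lemma Z_weta_eq:
  fixes A :: "real^'n^'m"
  assumes w: "\<And>j. 0 < w $ j"
  shows "Z_weta A w \<eta> = box_transform A w (\<lambda>_. {0..}) \<eta>" "Z_weta A w \<eta> \<noteq> 0"
proof -
  have "(LINT x:prod_set (\<lambda>_. UNIV)|lborel. cweight A w \<eta> x) = box_transform A w (\<lambda>_. {0..}) \<eta>"
    using w by (intro set_integral_cweight) (auto simp: prod_set_UNIV orthant_prod_set is_interval_ci)
  then show *: "Z_weta A w \<eta> = box_transform A w (\<lambda>_. {0..}) \<eta>"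
    by (simp add: Z_weta_def prod_set_UNIV set_lebesgue_integral_def)
  have "tilt A w \<eta> j \<noteq> 0" for j using w[of j] Re_tilt[of A w \<eta> j] by auto
  then show "Z_weta A w \<eta> \<noteq> 0"
    unfolding * box_transform_def using w by (simp add: integral_exp_Ici Re_tilt)
qed

lemma inner_matrix_vector: "\<eta> \<bullet> (A *v x) = (\<Sum>j\<in>UNIV. (\<eta> \<bullet> column j A) * x $ j)"
  by (simp add: matrix_mult_sum inner_sum_right scalar_mult_eq_scaleR mult.commute)

lemma mix_dens_eq:
  fixes A :: "real^'n^'m"
  assumes w: "\<And>j. 0 < w $ j"
  shows "mix_dens A b w \<eta> = complex_of_real (\<Prod>j\<in>UNIV. w $ j) * iexp (- (\<eta> \<bullet> b)) * Z_weta A w \<eta>"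
proof -
  let ?d = "\<lambda>x. (\<Prod>j\<in>UNIV. w $ j) * exp (- (\<Sum>j\<in>UNIV. w $ j * x $ j)) * indicator orthant x"
  have [measurable]: "(orthant :: (real^'n) set) \<in> sets borel"
    unfolding orthant_prod_set by (intro sets_prod_set) auto
  have "mix_dens A b w \<eta> = (LINT x|lborel. ?d x *\<^sub>R iexp ((\<Sum>j\<in>UNIV. (\<eta> \<bullet> column j A) * x $ j) - \<eta> \<bullet> b))"
    unfolding mix_dens_def P_exp_def using less_imp_le[OF w]
    by (intro integral_density) (auto intro!: AE_I2 mult_nonneg_nonneg prod_nonneg)
  also have "\<dots> = (LINT x|lborel. (complex_of_real (\<Prod>j\<in>UNIV. w $ j) * iexp (- (\<eta> \<bullet> b))) * cweight A w \<eta> x)"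
  proof (rule Bochner_Integration.integral_cong[OF refl])
    fix x :: "real^'n"
    have "exp (- (\<Sum>j\<in>UNIV. (complex_of_real (w$j) - \<i> * complex_of_real (\<eta> \<bullet> column j A)) * complex_of_real (x$j)))
      = exp (complex_of_real (- (\<Sum>j\<in>UNIV. w $ j * x $ j)) + \<i> * complex_of_real (\<Sum>j\<in>UNIV. (\<eta> \<bullet> column j A) * x $ j))"
      by (simp add: algebra_simps sum_subtractf sum_distrib_left)
    also have "\<dots> = complex_of_real (exp (- (\<Sum>j\<in>UNIV. w $ j * x $ j))) * iexp (\<Sum>j\<in>UNIV. (\<eta> \<bullet> column j A) * x $ j)"
      by (simp add: exp_add exp_of_real flip: of_real_minus)
    finally have c: "cweight A w \<eta> x = complex_of_real (exp (- (\<Sum>j\<in>UNIV. w $ j * x $ j))) * iexp (\<Sum>j\<in>UNIV. (\<eta> \<bullet> column j A) * x $ j) * indicator orthant x"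
      by (simp add: cweight_def)
    have "iexp ((\<Sum>j\<in>UNIV. (\<eta> \<bullet> column j A) * x $ j) - \<eta> \<bullet> b) = iexp (\<Sum>j\<in>UNIV. (\<eta> \<bullet> column j A) * x $ j) * iexp (- (\<eta> \<bullet> b))"
      by (simp only: mult_exp_exp diff_conv_add_uminus of_real_add distrib_left)
    then show "?d x *\<^sub>R iexp ((\<Sum>j\<in>UNIV. (\<eta> \<bullet> column j A) * x $ j) - \<eta> \<bullet> b)
      = (complex_of_real (\<Prod>j\<in>UNIV. w $ j) * iexp (- (\<eta> \<bullet> b))) * cweight A w \<eta> x"
      unfolding c by (simp only: scaleR_conv_of_real of_real_mult of_real_indicator mult_ac)
  qed
  also have "\<dots> = complex_of_real (\<Prod>j\<in>UNIV. w $ j) * iexp (- (\<eta> \<bullet> b)) * Z_weta A w \<eta>"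
    by (simp add: Z_weta_def)
  finally show ?thesis .
qed

text \<open>The divisor \<open>Z_weta\<close> of \<open>P_weta\<close> cancels the factor
  \<open>Z_weta\<close> of \<open>mix_dens\<close>. What remains has the shape of
  \<open>mix_dens\<close> itself with the trimmed box in place of the orthant, which makes numerator
  and denominator instances of one integral.\<close>

lemma P_weta_mult_mix_dens:
  fixes A :: "real^'n^'m"
  assumes w: "\<And>j. 0 < w $ j" and E: "\<And>j. is_interval (E j)"
  shows "P_weta A w \<eta> (prod_set E) * mix_dens A b w \<eta> =
    complex_of_real (\<Prod>j\<in>UNIV. w $ j) * (iexp (- (\<eta> \<bullet> b)) * box_transform A w (\<lambda>j. E j \<inter> {0..}) \<eta>)"
proof -
  have "(LINT x:prod_set E|lborel. cweight A w \<eta> x) = box_transform A w (\<lambda>j. E j \<inter> {0..}) \<eta>"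
    using w E by (intro set_integral_cweight) (auto simp: prod_set_def orthant_def is_interval_ci intro: is_interval_Int)
  then show ?thesis
    using Z_weta_eq(2)[OF w, of A \<eta>] by (simp add: P_weta_def mix_dens_eq[OF w])
qed

context slice
begin

context
  fixes J :: "'n \<Rightarrow> real set"
  assumes J: "\<And>j. is_interval (J j)" "\<And>j. J j \<subseteq> {0..}"
begin

lemma box_transform_eq_wgt:
  "iexp (- (\<eta> \<bullet> b)) * box_transform A w J \<eta> = (LINT x|lborel. iexp (\<eta> \<bullet> (A *v x - b)) * complex_of_real (wgt J x))"
proof -
  have i: "integrable lborel (\<lambda>x. exp (- (tilt A w \<eta> j * complex_of_real x)) * indicator (J j) x)" for j
    using wpos J by (intro integrable_exp_on real_interval_borel_measurable) (auto simp: Re_tilt)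
  have "iexp (- (\<eta> \<bullet> b)) * (\<Prod>j\<in>UNIV. exp (- (tilt A w \<eta> j * complex_of_real (x $ j))) * indicator (J j) (x $ j))
     = iexp (\<eta> \<bullet> (A *v x - b)) * complex_of_real (wgt J x)" for x
  proof -
    have "(\<Prod>j\<in>UNIV. exp (- (tilt A w \<eta> j * complex_of_real (x $ j)))) = exp (- (\<Sum>j\<in>UNIV. tilt A w \<eta> j * complex_of_real (x $ j)))"
      by (simp add: exp_sum[symmetric] sum_negf)
    also have "- (\<Sum>j\<in>UNIV. tilt A w \<eta> j * complex_of_real (x $ j)) = complex_of_real (- (w \<bullet> x)) + \<i> * complex_of_real (\<eta> \<bullet> (A *v x))"
      unfolding inner_matrix_vector inner_vec_def[of w x]
      by (simp add: tilt_def algebra_simps sum_subtractf sum_distrib_left)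
    finally have e: "(\<Prod>j\<in>UNIV. exp (- (tilt A w \<eta> j * complex_of_real (x $ j)))) = complex_of_real (exp (- (w \<bullet> x))) * iexp (\<eta> \<bullet> (A *v x))"
      by (simp only: exp_add exp_of_real)
    have "iexp (\<eta> \<bullet> (A *v x - b)) = iexp (- (\<eta> \<bullet> b)) * iexp (\<eta> \<bullet> (A *v x))"
    proof -
      have "\<eta> \<bullet> (A *v x - b) = - (\<eta> \<bullet> b) + \<eta> \<bullet> (A *v x)" by (simp add: inner_diff_right)
      then show ?thesis by (simp only: mult_exp_exp of_real_add distrib_left)
    qed
    then show ?thesis
      unfolding wgt_def prod.distrib e
      by (simp only: indicator_prod_set[symmetric] of_real_mult of_real_indicator mult_ac)
  qed
  note * = this
  have "iexp (- (\<eta> \<bullet> b)) * box_transform A w J \<eta> = (LINT x|lborel. iexp (- (\<eta> \<bullet> b)) *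
      (\<Prod>j\<in>UNIV. exp (- (tilt A w \<eta> j * complex_of_real (x $ j))) * indicator (J j) (x $ j)))"
    unfolding box_transform_def integral_vec_prod[OF i, symmetric] by simp
  then show ?thesis unfolding * .
qed

lemma norm_box_transform_le:
  "norm (box_transform A w J \<eta>) \<le> (\<Prod>j\<in>UNIV. 2 / min (w $ j) 1) * (\<Prod>j\<in>UNIV. (1 + (\<eta> \<bullet> column j A)\<^sup>2) powr (- 1 / 2))"
proof -
  have "norm (box_transform A w J \<eta>) \<le> (\<Prod>j\<in>UNIV. 2 / min (w $ j) 1 * (1 + (\<eta> \<bullet> column j A)\<^sup>2) powr (- 1 / 2))"
    unfolding box_transform_def prod_norm[symmetric]
  proof (intro prod_mono conjI)
    fix j :: 'n
    have "norm (LINT x|lborel. exp (- (tilt A w \<eta> j * complex_of_real x)) * indicator (J j) x) \<le> 2 / norm (tilt A w \<eta> j)"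
      using wpos J by (intro norm_integral_exp_interval_le) (auto simp: Re_tilt)
    also have "\<dots> = 2 * (1 / norm (tilt A w \<eta> j))" by simp
    also have "\<dots> \<le> 2 * (1 / min (w $ j) 1 * (1 + (\<eta> \<bullet> column j A)\<^sup>2) powr (- 1 / 2))"
      unfolding tilt_def by (intro mult_left_mono inverse_norm_le_decay wpos) simp
    finally show "norm (LINT x|lborel. exp (- (tilt A w \<eta> j * complex_of_real x)) * indicator (J j) x)
       \<le> 2 / min (w $ j) 1 * (1 + (\<eta> \<bullet> column j A)\<^sup>2) powr (- 1 / 2)" by simp
  qed simp
  then show ?thesis by (simp only: prod.distrib)
qed

lemma integrable_box_transform:
  assumes col: "\<And>j. dim {column i A | i. i \<noteq> j} = CARD('m)"
  shows "integrable lborel (\<lambda>\<eta>. iexp (- (\<eta> \<bullet> b)) * box_transform A w J \<eta>)"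
proof (rule Bochner_Integration.integrable_bound)
  have "1 < CARD('n)"
    using dims zero_less_card_finite[where 'a='d] zero_less_card_finite[where 'a='m] by linarith
  then show "integrable lborel (\<lambda>\<eta>. (\<Prod>j\<in>UNIV. 2 / min (w $ j) 1) * (\<Prod>j\<in>UNIV. (1 + (\<eta> \<bullet> column j A)\<^sup>2) powr (- 1 / 2)))"
    by (intro integrable_mult_right integrable_prod_column_decay col)
  have [measurable]: "J j \<in> sets borel" for j by (rule real_interval_borel_measurable[OF J(1)])
  have "(\<lambda>\<eta>. LINT x|lborel. exp (- (tilt A w \<eta> j * complex_of_real x)) * indicator (J j) x) \<in> borel_measurable borel" for j
    unfolding tilt_def by measurable
  then show "(\<lambda>\<eta>. iexp (- (\<eta> \<bullet> b)) * box_transform A w J \<eta>) \<in> borel_measurable lborel"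
    unfolding box_transform_def by measurable
  show "AE \<eta> in lborel. norm (iexp (- (\<eta> \<bullet> b)) * box_transform A w J \<eta>) \<le>
     norm ((\<Prod>j\<in>UNIV. 2 / min (w $ j) 1) * (\<Prod>j\<in>UNIV. (1 + (\<eta> \<bullet> column j A)\<^sup>2) powr (- 1 / 2)))"
  proof (rule AE_I2)
    fix \<eta>
    have "norm (iexp (- (\<eta> \<bullet> b)) * box_transform A w J \<eta>) = norm (box_transform A w J \<eta>)"
      by (simp only: norm_mult norm_exp_i_times mult_1)
    also have "\<dots> \<le> norm ((\<Prod>j\<in>UNIV. 2 / min (w $ j) 1) * (\<Prod>j\<in>UNIV. (1 + (\<eta> \<bullet> column j A)\<^sup>2) powr (- 1 / 2)))"
      using norm_box_transform_le[of \<eta>] by (rule order_trans) simp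
    finally show "norm (iexp (- (\<eta> \<bullet> b)) * box_transform A w J \<eta>) \<le>
     norm ((\<Prod>j\<in>UNIV. 2 / min (w $ j) 1) * (\<Prod>j\<in>UNIV. (1 + (\<eta> \<bullet> column j A)\<^sup>2) powr (- 1 / 2)))" .
  qed
qed

end

text \<open>The damped integral is followed along widths \<open>1 / Suc k\<close> in two ways:
  integrability of the transform removes the damping by dominated convergence, while
  \<open>Fubini_gauss\<close> and \<open>slice_limit\<close> identify the limit as a multiple of the
  slice volume.\<close>

lemma integral_box_transform:
  assumes col: "\<And>j. dim {column i A | i. i \<noteq> j} = CARD('m)"
  obtains c where "0 < c" "\<And>J. (\<And>j. is_interval (J j)) \<Longrightarrow> (\<And>j. J j \<subseteq> {0..}) \<Longrightarrow>
    (LINT \<eta>|lborel. iexp (- (\<eta> \<bullet> b)) * box_transform A w J \<eta>) = complex_of_real (c * measure lborel {y. x0 + L y \<in> prod_set J})"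
proof -
  obtain D where D: "0 < D" "\<And>J t. (\<And>j. is_interval (J j)) \<Longrightarrow> (\<And>j. J j \<subseteq> {0..}) \<Longrightarrow> 0 < t \<Longrightarrow>
    (LINT x|lborel. wgt J x * ((sqrt (2 * pi) / t) ^ CARD('m) * exp (- ((norm (A *v x - b))\<^sup>2 / (2 * t\<^sup>2)))))
    = D * sqrt (2 * pi) ^ CARD('m) * (LINT p|(lborel \<Otimes>\<^sub>M lborel). wgt J (x0 + L (fst p) + R (t *\<^sub>R snd p)) * exp (- (1/2) * (norm (snd p))\<^sup>2))"
    using slice_change_of_variables by blast
  \<comment> \<open>One power of \<open>sqrt (2 * pi)\<close> comes from transforming the damping
    Gaussian, the other from integrating the Gaussian in \<open>v\<close>; together they form the
    usual \<open>(2 * pi) ^ CARD('m)\<close> of Fourier inversion.\<close>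
  let ?c = "D * sqrt (2 * pi) ^ CARD('m) * (exp (- (w \<bullet> x0)) * sqrt (2 * pi) ^ CARD('m))"
  show thesis
  proof (rule that[of ?c])
    show "0 < ?c" using D(1) by simp
    fix J :: "'n \<Rightarrow> real set" assume J: "\<And>j. is_interval (J j)" "\<And>j. J j \<subseteq> {0..}"
    let ?\<Psi> = "\<lambda>\<eta>. iexp (- (\<eta> \<bullet> b)) * box_transform A w J \<eta>"
    have int: "integrable lborel ?\<Psi>" by (rule integrable_box_transform[OF J col])
    let ?t = "\<lambda>k::nat. 1 / real (Suc k)"
    let ?g = "\<lambda>k \<eta>. complex_of_real (exp (- ((?t k)\<^sup>2 * (norm (\<eta> :: real^'m))\<^sup>2 / 2)))"
    have "(\<lambda>k. LINT \<eta>|lborel. ?g k \<eta> * ?\<Psi> \<eta>) \<longlonglongrightarrow> (LINT \<eta>|lborel. ?\<Psi> \<eta>)"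
    proof (rule integral_dominated_convergence[where w="\<lambda>\<eta>. norm (?\<Psi> \<eta>)"])
      show "?\<Psi> \<in> borel_measurable lborel" using int by (rule borel_measurable_integrable)
      then show "(\<lambda>\<eta>. ?g k \<eta> * ?\<Psi> \<eta>) \<in> borel_measurable lborel" for k by measurable
      show "integrable lborel (\<lambda>\<eta>. norm (?\<Psi> \<eta>))" using int by (rule integrable_norm)
      show "AE \<eta> in lborel. (\<lambda>k. ?g k \<eta> * ?\<Psi> \<eta>) \<longlonglongrightarrow> ?\<Psi> \<eta>"
      proof (rule AE_I2)
        fix \<eta> :: "real^'m"
        have "(\<lambda>k. ?t k) \<longlonglongrightarrow> 0" by (intro LIMSEQ_Suc lim_const_over_n)
        then have "(\<lambda>k. ?g k \<eta>) \<longlonglongrightarrow> complex_of_real (exp (- (0\<^sup>2 * (norm \<eta>)\<^sup>2 / 2)))"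
          by (intro tendsto_intros) auto
        from tendsto_mult[OF this tendsto_const[of "?\<Psi> \<eta>"]]
        show "(\<lambda>k. ?g k \<eta> * ?\<Psi> \<eta>) \<longlonglongrightarrow> ?\<Psi> \<eta>" by simp
      qed
      show "AE \<eta> in lborel. norm (?g k \<eta> * ?\<Psi> \<eta>) \<le> norm (?\<Psi> \<eta>)" for k
      proof (rule AE_I2)
        fix \<eta> :: "real^'m"
        have "norm (?g k \<eta>) \<le> 1" by (simp del: of_nat_Suc)
        then show "norm (?g k \<eta> * ?\<Psi> \<eta>) \<le> norm (?\<Psi> \<eta>)"
          unfolding norm_mult[of "?g k \<eta>"] by (intro mult_left_le_one_le) auto
      qed
    qed
    moreover have "(\<lambda>k. LINT \<eta>|lborel. ?g k \<eta> * ?\<Psi> \<eta>) \<longlonglongrightarrow> complex_of_real (?c * measure lborel {y. x0 + L y \<in> prod_set J})"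
    proof -
      have "(LINT \<eta>|lborel. ?g k \<eta> * ?\<Psi> \<eta>) = complex_of_real (D * sqrt (2 * pi) ^ CARD('m) *
         (LINT p|(lborel \<Otimes>\<^sub>M lborel). wgt J (x0 + L (fst p) + R (?t k *\<^sub>R snd p)) * exp (- (1/2) * (norm (snd p))\<^sup>2)))" for k
        unfolding box_transform_eq_wgt[OF J]
        by (subst Fubini_gauss[OF J]; (subst D(2)[OF J])?; simp del: of_nat_Suc)
      moreover have "(\<lambda>k. complex_of_real (D * sqrt (2 * pi) ^ CARD('m) *
         (LINT p|(lborel \<Otimes>\<^sub>M lborel). wgt J (x0 + L (fst p) + R (?t k *\<^sub>R snd p)) * exp (- (1/2) * (norm (snd p))\<^sup>2))))
         \<longlonglongrightarrow> complex_of_real (D * sqrt (2 * pi) ^ CARD('m) * (exp (- (w \<bullet> x0)) * sqrt (2 * pi) ^ CARD('m) * measure lborel {y. x0 + L y \<in> prod_set J}))"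
        by (intro tendsto_of_real tendsto_mult_left slice_limit J)
      ultimately show ?thesis by (simp only: mult.assoc)
    qed
    ultimately show "(LINT \<eta>|lborel. ?\<Psi> \<eta>) = complex_of_real (?c * measure lborel {y. x0 + L y \<in> prod_set J})"
      by (rule LIMSEQ_unique)
  qed
qed

end

section \<open>Kernel and row space of the matrix\<close>

lemma kernel_not_in_coordinate_hyperplane:
  fixes A :: "real^'n^'m"
  assumes "dim {column i A | i. i \<noteq> j} = CARD('m)"
  obtains x where "A *v x = 0" "x $ j \<noteq> 0"
proof -
  let ?S = "{column i A | i. i \<noteq> j}"
  let ?T = "{A *v x | x. x $ j = 0}"
  have "subspace ?T"
    unfolding subspace_def
  proof (intro conjI ballI allI)
    show "0 \<in> ?T" by (auto intro!: exI[of _ 0])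
    fix x y assume "x \<in> ?T" "y \<in> ?T"
    then show "x + y \<in> ?T" by (force simp: matrix_vector_right_distrib[symmetric])
  next
    fix c x assume "x \<in> ?T"
    then show "c *\<^sub>R x \<in> ?T" by (force simp: matrix_vector_mult_scaleR[symmetric])
  qed
  moreover have "?S \<subseteq> ?T"
  proof
    fix v assume "v \<in> ?S"
    then obtain i where i: "v = column i A" "i \<noteq> j" by blast
    have "v = A *v axis i 1" by (simp only: i(1) matrix_vector_mult_basis)
    moreover have "axis i (1::real) $ j = 0" using i(2) by (simp add: axis_def)
    ultimately show "v \<in> ?T" by (intro CollectI exI conjI)
  qed
  ultimately have "span ?S \<subseteq> ?T" by (simp add: span_minimal)
  moreover have "span ?S = UNIV" using assms dim_eq_full[of ?S] by simp
  \<comment> \<open>The deleted column is a combination of the remaining ones, and subtracting that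
    combination from \<open>axis j 1\<close> gives a kernel vector with coordinate 1 at
    \<open>j\<close>.\<close>
  ultimately have "column j A \<in> ?T" by auto
  then obtain x where x: "A *v x = column j A" "x $ j = 0" by auto
  have "A *v (axis j 1 - x) = 0"
    by (simp add: matrix_vector_mult_diff_distrib matrix_vector_mult_basis x)
  moreover have "(axis j 1 - x) $ j \<noteq> 0" by (simp add: x)
  ultimately show thesis by (rule that)
qed

text \<open>The kernel is the orthogonal complement of the row span.\<close>

lemma dim_kernel:
  fixes A :: "real^'n^'m"
  shows "dim {x. A *v x = 0} = CARD('n) - rank A"
proof -
  have "dim {y \<in> UNIV. \<forall>x \<in> span (rows A). orthogonal x y} + dim (span (rows A)) = dim (UNIV :: (real^'n) set)"
    by (rule dim_subspace_orthogonal_to_vectors) auto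
  moreover have "{y \<in> UNIV. \<forall>x \<in> span (rows A). orthogonal x y} = {x. A *v x = 0}"
  proof -
    have "(\<forall>x\<in>span (rows A). orthogonal x y) \<longleftrightarrow> (\<forall>x\<in>rows A. orthogonal x y)" for y
    proof
      assume *: "\<forall>x\<in>rows A. orthogonal x y"
      show "\<forall>x\<in>span (rows A). orthogonal x y"
      proof
        fix x assume "x \<in> span (rows A)"
        then have "orthogonal y x" by (rule orthogonal_to_span) (use * in \<open>simp add: orthogonal_commute\<close>)
        then show "orthogonal x y" by (simp add: orthogonal_commute)
      qed
    qed (simp add: span_base)
    moreover have "(\<forall>x\<in>rows A. orthogonal x y) \<longleftrightarrow> A *v y = 0" for y
      by (auto simp: rows_def orthogonal_def vec_eq_iff matrix_vector_mult_def row_def inner_vec_def)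
    ultimately show ?thesis by simp
  qed
  ultimately show ?thesis by (simp add: row_rank_def)
qed

lemma row_span_orthogonal_kernel:
  fixes A :: "real^'n^'m"
  assumes "w \<in> span (rows A)" "A *v x = 0"
  shows "w \<bullet> x = 0"
proof -
  have "orthogonal x v" if "v \<in> rows A" for v
    using that assms(2) by (auto simp: rows_def orthogonal_def vec_eq_iff matrix_vector_mult_def row_def inner_vec_def mult.commute)
  from orthogonal_to_span[OF assms(1) this] show ?thesis
    by (simp add: orthogonal_def inner_commute)
qed

theorem theorem2p3:
  fixes A :: "real^'n^'m" and b :: "real^'m" and w :: "real^'n"
  assumes nm: "CARD('m) < CARD('n)"
    and rankA: "rank A = CARD('m)"
    and Apos: "\<forall>i j. 0 < A$i$j"
    and bpos: "\<forall>i. 0 < b$i"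
    and Kcomp: "compact (Kpoly A b)"
    and Kint: "\<exists>x\<in>Kpoly A b. \<forall>j. 0 < x$j"
    and w_row: "w \<in> span (rows A)"
    and wpos: "\<forall>j. 0 < w$j"
    and col_del: "\<forall>j. dim {column i A | i. i \<noteq> j} = CARD('m)"
  shows "integrable lborel (mix_dens A b w) \<and> Z_mix A b w \<noteq> 0
       \<and> (\<forall>\<eta>. set_integrable lborel orthant (cweight A w \<eta>) \<and> Z_weta A w \<eta> \<noteq> 0)
       \<and> (\<forall>E :: 'n \<Rightarrow> real set. (\<forall>j. is_interval (E j)) \<longrightarrow>
            (let Ebox = {x :: real^'n. \<forall>j. x$j \<in> E j} in
              integrable lborel (\<lambda>\<eta>. P_weta A w \<eta> Ebox * mix_dens A b w \<eta>) \<and>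
              complex_of_real (P_unif A b Ebox) =
                (LINT \<eta>|lborel. P_weta A w \<eta> Ebox * mix_dens A b w \<eta>) / Z_mix A b w))"
proof -
  obtain x0 where x0_pos: "x0 \<in> Kpoly A b" "\<And>j. 0 < x0 $ j" using Kint by blast
  then have Ax0: "A *v x0 = b" by (simp add: Kpoly_def)
  have w: "0 < w $ j" for j using wpos by simp
  let ?ker = "{x. A *v x = 0}"
  have card: "CARD(('n, 'm) codim) = CARD('n) - CARD('m)" by (rule card_codim[OF nm])
  have "subspace ?ker"
    by (auto simp: subspace_def matrix_vector_right_distrib matrix_vector_mult_scaleR)
  moreover have "dim (UNIV :: (real^('n, 'm) codim) set) = dim ?ker"
    by (simp add: dim_kernel rankA card)
  \<comment> \<open>Equal dimensions give a linear isometry onto the kernel; preserving distances is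
    what lets Hausdorff measure on the slice be read off in parameters.\<close>
  ultimately obtain L :: "real^('n, 'm) codim \<Rightarrow> real^'n" where L: "linear L" "range L = ?ker" "\<And>y. norm (L y) = norm y"
    using isometries_subspaces[OF subspace_UNIV, of ?ker] by (metis UNIV_I)
  have AL: "A *v L y = 0" for y using L(2) by auto
  obtain B where B: "A ** B = mat 1"
    using rankA matrix_right_invertible_surjective[of A] by (auto simp: full_rank_surjective)
  interpret slice A b w x0 L "(*v) B"
  proof (rule slice.intro)
    show "linear L" by (rule L(1))
    show "linear ((*v) B)" by (rule matrix_vector_mul_linear)
    show "A *v (B *v v) = v" for v by (simp add: matrix_vector_mul_assoc B)
    show "\<exists>y. L y $ j \<noteq> 0" for j
    proof -
      obtain x where x: "A *v x = 0" "x $ j \<noteq> 0"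
        by (rule kernel_not_in_coordinate_hyperplane[OF col_del[rule_format, of j]])
      then have "x \<in> range L" using L(2) by simp
      with x(2) show ?thesis by auto
    qed
    show "x \<in> range L" if "A *v x = 0" for x using that L(2) by simp
    show "w \<bullet> x = 0" if "A *v x = 0" for x by (rule row_span_orthogonal_kernel[OF w_row that])
    show "CARD(('n, 'm) codim) + CARD('m) = CARD('n)" using card nm by simp
  qed (rule L(3) AL Ax0 w)+
  have col: "dim {column i A | i. i \<noteq> j} = CARD('m)" for j using col_del by simp
  let ?W = "complex_of_real (\<Prod>j\<in>UNIV. w $ j)"
  let ?I = "\<lambda>J \<eta>. iexp (- (\<eta> \<bullet> b)) * box_transform A w J \<eta>"
  let ?Y = "\<lambda>J. {y. x0 + L y \<in> prod_set J}"
  let ?Jpos = "\<lambda>_::'n. {0::real..}"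
  have Jpos: "is_interval (?Jpos j)" "?Jpos j \<subseteq> {0..}" for j by (auto simp: is_interval_ci)
  obtain c where c: "0 < c" "\<And>J. (\<And>j. is_interval (J j)) \<Longrightarrow> (\<And>j. J j \<subseteq> {0..}) \<Longrightarrow>
    (LINT \<eta>|lborel. ?I J \<eta>) = complex_of_real (c * measure lborel (?Y J))"
    by (rule integral_box_transform[OF col]) blast
  have W: "?W \<noteq> 0" using w by (simp add: less_imp_neq[symmetric])

  have mix: "mix_dens A b w = (\<lambda>\<eta>. ?W * ?I ?Jpos \<eta>)"
    by (rule ext) (simp only: mix_dens_eq[OF w] Z_weta_eq(1)[OF w] mult.assoc)
  have int_mix: "integrable lborel (mix_dens A b w)"
    unfolding mix by (intro integrable_mult_right integrable_box_transform Jpos col)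
  have Z: "Z_mix A b w = ?W * complex_of_real (c * measure lborel (?Y ?Jpos))"
    unfolding Z_mix_def mix integral_mult_right_zero c(2)[OF Jpos] by (rule refl)

  \<comment> \<open>Intersecting with \<open>{0..}\<close> accounts for the sign condition in
    \<open>Kpoly\<close>, so the polytope part in the box is an isometric image of a parameter
    set.\<close>
  have slice_image: "{x. \<forall>j. x $ j \<in> E j} \<inter> Kpoly A b = (\<lambda>y. x0 + L y) ` ?Y (\<lambda>j. E j \<inter> {0..})" for E
  proof (intro equalityI subsetI)
    fix x assume x: "x \<in> {x. \<forall>j. x $ j \<in> E j} \<inter> Kpoly A b"
    then have "A *v (x - x0) = 0" by (simp add: Kpoly_def matrix_vector_mult_diff_distrib Ax0)
    then obtain y where "x - x0 = L y" using kerL by auto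
    then have "x = x0 + L y" by (simp add: algebra_simps)
    then show "x \<in> (\<lambda>y. x0 + L y) ` ?Y (\<lambda>j. E j \<inter> {0..})"
      using x by (auto simp: prod_set_def Kpoly_def)
  qed (auto simp: prod_set_def Kpoly_def matrix_vector_right_distrib AL Ax0)
  \<comment> \<open>Compactness of the polytope passes to the parameters through the isometry and
    makes all slice volumes finite.\<close>
  have bdd: "bounded (?Y (\<lambda>j. E j \<inter> {0..}))" for E :: "'n \<Rightarrow> real set"
  proof -
    obtain M where M: "\<And>x. x \<in> Kpoly A b \<Longrightarrow> norm x \<le> M"
      using compact_imp_bounded[OF Kcomp] by (auto simp: bounded_iff)
    have "norm y \<le> M + norm x0" if "y \<in> ?Y (\<lambda>j. E j \<inter> {0..})" for y
    proof -
      have "x0 + L y \<in> Kpoly A b" using that slice_image[of E] by blast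
      then have "norm (x0 + L y) \<le> M" by (rule M)
      then show ?thesis using norm_triangle_ineq4[of "x0 + L y" x0] L(3)[of y] by simp
    qed
    then show ?thesis by (auto simp: bounded_iff)
  qed
  have mes: "?Y J \<in> sets borel" if "\<And>j. is_interval (J j)" for J :: "'n \<Rightarrow> real set"
    using that by (intro measurable_sets_borel[of "\<lambda>y. x0 + L y" borel, unfolded vimage_def] sets_prod_set
      real_interval_borel_measurable) auto
  obtain h where h: "0 < h" "\<And>S. bounded S \<Longrightarrow> S \<in> sets borel \<Longrightarrow>
      hausdorff_measure (real (CARD('n) - CARD('m))) ((\<lambda>y. x0 + L y) ` S) = ennreal h * emeasure lborel S"
  proof -
    have "dist (x0 + L y) (x0 + L z) = dist y z" for y z
      using L(3)[of "y - z"] L(1) by (simp add: dist_norm linear_diff)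
    from hausdorff_measure_isometry_image[of "\<lambda>y. x0 + L y", OF this, of "real (CARD('n) - CARD('m))"]
    show thesis using that card by auto
  qed
  have H: "enn2real (hausdorff_measure (real (CARD('n) - CARD('m))) ({x. \<forall>j. x $ j \<in> E j} \<inter> Kpoly A b))
      = h * measure lborel (?Y (\<lambda>j. E j \<inter> {0..}))" if E: "\<And>j. is_interval (E j)" for E
  proof -
    have "?Y (\<lambda>j. E j \<inter> {0..}) \<in> sets borel" using E by (intro mes is_interval_Int) (auto simp: is_interval_ci)
    then show ?thesis
      unfolding slice_image by (subst h(2)[OF bdd]) (use h(1) in \<open>simp_all add: enn2real_mult measure_def\<close>)
  qed

  have Y0: "0 < measure lborel (?Y ?Jpos)"
  proof -
    \<comment> \<open>A parameter of norm below the smallest coordinate of \<open>x0\<close> changes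
      no coordinate by more than that amount, so a whole ball of parameters stays in the
      polytope.\<close>
    define e where "e = Min (range (\<lambda>j. x0 $ j))"
    have e: "0 < e" "e \<le> x0 $ j" for j
      unfolding e_def using x0_pos(2) by (subst Min_gr_iff; auto) (rule Min_le; auto)
    have "ball 0 e \<subseteq> ?Y ?Jpos"
    proof
      fix y :: "real^('n, 'm) codim" assume "y \<in> ball 0 e"
      then have "\<bar>L y $ j\<bar> < e" for j
        using component_le_norm_cart[of "L y" j] L(3)[of y] by simp
      then have "0 \<le> x0 $ j + L y $ j" for j using e(2)[of j] by (smt (verit))
      then show "y \<in> ?Y ?Jpos" by (simp add: prod_set_def)
    qed
    moreover have "emeasure lborel (?Y ?Jpos) < \<infinity>"
      using emeasure_bounded_finite[OF bdd[of "\<lambda>_. UNIV"]] by simp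
    ultimately have "measure lborel (ball 0 e :: (real^('n, 'm) codim) set) \<le> measure lborel (?Y ?Jpos)"
      using mes[of ?Jpos] Jpos(1) by (intro measure_mono_fmeasurable) (auto simp: fmeasurable_def)
    moreover have "0 < measure lborel (ball 0 e :: (real^('n, 'm) codim) set)"
      using content_ball_pos[OF e(1)] by simp
    ultimately show ?thesis by linarith
  qed
  have Z0: "Z_mix A b w \<noteq> 0" unfolding Z using W c(1) Y0 by simp

  have so: "set_integrable lborel orthant (cweight A w \<eta>)" for \<eta>
    unfolding orthant_prod_set
    by (rule set_integrable_cweight[OF w Jpos]) (simp add: orthant_prod_set)

  have main: "integrable lborel (\<lambda>\<eta>. P_weta A w \<eta> {x. \<forall>j. x $ j \<in> E j} * mix_dens A b w \<eta>) \<and>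
      complex_of_real (P_unif A b {x. \<forall>j. x $ j \<in> E j}) =
        (LINT \<eta>|lborel. P_weta A w \<eta> {x. \<forall>j. x $ j \<in> E j} * mix_dens A b w \<eta>) / Z_mix A b w"
    if E: "\<And>j. is_interval (E j)" for E :: "'n \<Rightarrow> real set"
  proof
    let ?J = "\<lambda>j. E j \<inter> {0..}"
    have J: "is_interval (?J j)" "?J j \<subseteq> {0..}" for j
      using E by (auto intro!: is_interval_Int simp: is_interval_ci)
    have eq: "P_weta A w \<eta> {x. \<forall>j. x $ j \<in> E j} * mix_dens A b w \<eta> = ?W * ?I ?J \<eta>" for \<eta>
      using P_weta_mult_mix_dens[where A=A and b=b and \<eta>=\<eta> and w=w and E=E, OF w E] by (simp only: prod_set_def)
    show "integrable lborel (\<lambda>\<eta>. P_weta A w \<eta> {x. \<forall>j. x $ j \<in> E j} * mix_dens A b w \<eta>)"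
      unfolding eq by (intro integrable_mult_right integrable_box_transform J col)
    have "(LINT \<eta>|lborel. P_weta A w \<eta> {x. \<forall>j. x $ j \<in> E j} * mix_dens A b w \<eta>) / Z_mix A b w
       = ?W * complex_of_real (c * measure lborel (?Y ?J)) / (?W * complex_of_real (c * measure lborel (?Y ?Jpos)))"
      unfolding eq integral_mult_right_zero c(2)[OF J] Z by (rule refl)
    also have "\<dots> = complex_of_real (measure lborel (?Y ?J) / measure lborel (?Y ?Jpos))"
      using W c(1) by simp
    \<comment> \<open>\<open>H\<close> is used for \<open>E\<close> and for the whole space, and the
      factor \<open>h\<close> cancels in the quotient.\<close>
    also have "measure lborel (?Y ?J) / measure lborel (?Y ?Jpos) = P_unif A b {x. \<forall>j. x $ j \<in> E j}"
      using H[OF E] H[of "\<lambda>_. UNIV"] h(1) by (simp add: P_unif_def)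
    finally show "complex_of_real (P_unif A b {x. \<forall>j. x $ j \<in> E j}) =
        (LINT \<eta>|lborel. P_weta A w \<eta> {x. \<forall>j. x $ j \<in> E j} * mix_dens A b w \<eta>) / Z_mix A b w" by (rule sym)
  qed
  show ?thesis
    unfolding Let_def using int_mix Z0 so Z_weta_eq(2)[OF w] main by blast
qed

end
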